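(* Consider a Uniform Linear Array (ULA) transmitter--receiver pair with associated data matrix $\boldsymbol{\Delta}=\mathbf{X}_r\mathbf{D}\mathbf{X}_t^{T}\in\mathbb{C}^{M_r\times M_t}$ (as defined in the context), and assume that the set of target angles $\{\theta_0,\dots,\theta_{K-1}\}$ consists of almost surely distinct members. Set $d_r=d_t=\lambda/2$. If additionally $$(\theta_i,\theta_j)\in\mathcal{A},\quad\text{with}\quad \mathcal{A}=\left\{(x,y)\in\left[-\tfrac{\pi}{2},\tfrac{\pi}{2}\right]^2 : \eta\le|y-x|\le\pi-\eta\right\},$$ for all $i,j\in\{0,\dots,K-1\}$ with $i\ne j$ and for some a priori chosen $\eta\in\left(0,\frac{\pi}{2}\right]$, then $$\xi=1-\cos\!\left(\frac{\eta}{2}\right)\in\left(0,\frac{2-\sqrt2}{2}\right]$$ and the following asymptotics always hold true: for any fixed $K$, as long as $\min_{i\in\{t,r\}}M_i\ge K\sqrt{\beta_\xi}=\mathcal{O}(K)$, $\boldsymbol{\Delta}$ obeys assumptions $\mathbf{A0}$ and $\mathbf{A1}$ (defined in the context) with probability $1$ with $$\mu_0=\max_{i\in\{t,r\}}\left\{\frac{M_i}{M_i-(K-1)\sqrt{\beta_\xi}}\right\}\quad\text{and}\quad\mu_1=\max_{i\in\{t,r\}}\left\{\frac{M_i\sqrt K}{M_i-(K-1)\sqrt{\beta_\xi}}\right\},$$ and, in the limit with respect to $M_t$ and $M_r$ (as these tend to infinity), $\mu(V)=\mu(U)=1$, that is, the coherence of $\boldsymbol{\Delta}$ is asymptotically optimal.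 In particular, the higher the value of $\eta$, the higher the value of $\xi$ and the lower the coherence of $\boldsymbol{\Delta}$.
   Context: Setting. $M_r,M_t$ are the numbers of reception and transmission antennas, $K$ is the number of targets, $\lambda>0$ is the carrier wavelength, $d_r,d_t>0$ are the antenna spacings of the receive and transmit ULAs, and $\theta_0,\dots,\theta_{K-1}$ are real (possibly random) target angles. $\mathbf{X}_r\in\mathbb{C}^{M_r\times K}$ is the Vandermonde matrix with entries $e^{j2\pi l d_r\sin(\theta_k)/\lambda}$ for $0\le l\le M_r-1$, $0\le k\le K-1$ ($j=\sqrt{-1}$); $\mathbf{X}_t\in\mathbb{C}^{M_t\times K}$ is defined analogously with $d_t$, $M_t$. $\mathbf{D}\in\mathbb{C}^{K\times K}$ is an arbitrary diagonal matrix with all diagonal entries nonzero. $(\cdot)^T$ is the transpose and $(\cdot)^H$ the conjugate transpose. Parameters. Let $g(x)=\lceil x\rceil-x$ if $\lceil x\rceil-x\le\frac12$ and $g(x)=x-\lfloor x\rfloor$ otherwise. For $k\in\{t,r\}$, $$\xi_k=\min_{\substack{i,j\in\{0,\dots,K-1\}\\ i\neq j}} g\!\left(\frac{d_k}{\lambda}\,|\sin\theta_i-\sin\theta_j|\right),\qquad \xi=\min\{\xi_r,\xi_t\},$$ and, when $\xi\ne0$, $$\beta_\xi=\sup_{x\in[\xi,\frac12],\,M\in\mathbb{R},\,M>0}\frac{\sin^2(\pi Mx)}{\sin^2(\pi x)}.$$ Coherence. For an $r$-dimensional subspace $U\subseteq\mathbb{C}^N$ with orthogonal projection $\mathbf{P}_U$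 and standard basis $\mathbf{e}_1,\dots,\mathbf{e}_N$, the coherence is $\mu(U)=\frac{N}{r}\sup_{1\le i\le N}\|\mathbf{P}_U\mathbf{e}_i\|_2^2\in[1,N/r]$. For a rank-$r$ matrix $\mathbf{M}\in\mathbb{C}^{N_1\times N_2}$ with compact SVD $\mathbf{M}=\sum_{i=1}^r\sigma_i\mathbf{u}_i\mathbf{v}_i^H$, put $U=\mathrm{span}\{\mathbf{u}_i\}$, $V=\mathrm{span}\{\mathbf{v}_i\}$. $\mathbf{M}$ obeys $\mathbf{A0}$ with $\mu_0>0$ if $\max\{\mu(U),\mu(V)\}\le\mu_0$, and $\mathbf{A1}$ with $\mu_1>0$ if $\left\|\sum_{i=1}^r\mathbf{u}_i\mathbf{v}_i^H\right\|_\infty\le\mu_1\sqrt{r/(N_1N_2)}$, where $\|\cdot\|_\infty$ is the largest absolute value of an entry. In the claim, $U$, $V$ and "the coherence of $\boldsymbol{\Delta}$" refer to $\mathbf{M}=\boldsymbol{\Delta}$.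
   Formalization: The equality ξ=1-cos(η/2) fails for given angles; it is proved as the attained minimum of ξ over admissible angles (K≥2) and an a.s. lower bound. A0, A1 hold with either value as ξ (K=1: with 1-cos(η/2)). "Lower coherence" is proved for the bound μ_0, strictly when K≥2. *)

theory Defs
  imports
    "HOL-Probability.Probability"
    "HOL-Library.Landau_Symbols"
    "Jordan_Normal_Form.Schur_Decomposition"
    "Jordan_Normal_Form.DL_Rank"
begin

unbundle no vec_syntax
unbundle no inner_syntax

text \<open>
  The matrix sizes are quantified inside the statement (and tend to infinity), so matrices and
  vectors are the dimension-carrying types \<open>complex mat\<close> and \<open>complex vec\<close>. All indices start at
  \<open>0\<close>, and families of \<open>K\<close> (or \<open>r\<close>) objects are functions on \<open>nat\<close> of which only the values below
  \<open>K\<close> (or \<open>r\<close>) are used.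
\<close>

definition steering_mat :: "real \<Rightarrow> real \<Rightarrow> nat \<Rightarrow> nat \<Rightarrow> (nat \<Rightarrow> real) \<Rightarrow> complex mat" where
  "steering_mat lam d M K \<theta> =
     mat M K (\<lambda>(l, k). exp (\<i> * of_real (2 * pi * real l * d * sin (\<theta> k) / lam)))"

definition data_mat ::
  "real \<Rightarrow> real \<Rightarrow> real \<Rightarrow> nat \<Rightarrow> nat \<Rightarrow> nat \<Rightarrow> (nat \<Rightarrow> real) \<Rightarrow> complex mat \<Rightarrow> complex mat" where
  "data_mat lam dr dt Mr Mt K \<theta> D =
     steering_mat lam dr Mr K \<theta> * D * transpose_mat (steering_mat lam dt Mt K \<theta>)"

definition nonzero_diag :: "nat \<Rightarrow> complex mat \<Rightarrow> bool" where
  "nonzero_diag K D \<longleftrightarrow>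
     D \<in> carrier_mat K K \<and> diagonal_mat D \<and> (\<forall>i<K. D $$ (i, i) \<noteq> 0)"

definition gap :: "real \<Rightarrow> real" where
  "gap x = (if of_int \<lceil>x\<rceil> - x \<le> 1/2 then of_int \<lceil>x\<rceil> - x else x - of_int \<lfloor>x\<rfloor>)"

text \<open>The minimum ranges over pairs of distinct indices; it is meaningful for \<open>K \<ge> 2\<close> only.\<close>

definition xi_one :: "real \<Rightarrow> real \<Rightarrow> nat \<Rightarrow> (nat \<Rightarrow> real) \<Rightarrow> real" where
  "xi_one lam d K \<theta> =
     Min {gap (d / lam * \<bar>sin (\<theta> i) - sin (\<theta> j)\<bar>) | i j. i < K \<and> j < K \<and> i \<noteq> j}"

definition xi :: "real \<Rightarrow> real \<Rightarrow> real \<Rightarrow> nat \<Rightarrow> (nat \<Rightarrow> real) \<Rightarrow> real" where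
  "xi lam dr dt K \<theta> = min (xi_one lam dr K \<theta>) (xi_one lam dt K \<theta>)"

text \<open>The variable \<open>M\<close> is a positive real here, not only a number of antennas.\<close>

definition beta :: "real \<Rightarrow> real" where
  "beta x0 = Sup {(sin (pi * M * x))\<^sup>2 / (sin (pi * x))\<^sup>2 | x M. x \<in> {x0..1/2} \<and> M > (0::real)}"

definition angle_region :: "real \<Rightarrow> (real \<times> real) set" where
  "angle_region \<eta> =
     {(x, y). x \<in> {-pi/2..pi/2} \<and> y \<in> {-pi/2..pi/2} \<and> \<eta> \<le> \<bar>y - x\<bar> \<and> \<bar>y - x\<bar> \<le> pi - \<eta>}"

definition admissible :: "real \<Rightarrow> nat \<Rightarrow> (nat \<Rightarrow> real) \<Rightarrow> bool" where
  "admissible \<eta> K \<theta> \<longleftrightarrow>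
     (\<forall>i<K. \<forall>j<K. i \<noteq> j \<longrightarrow> (\<theta> i, \<theta> j) \<in> angle_region \<eta>)"

definition cspan :: "nat \<Rightarrow> complex vec set \<Rightarrow> complex vec set" where
  "cspan N S = LinearCombinations.module.span class_ring (module_vec TYPE(complex) N) S"

definition cdim :: "nat \<Rightarrow> complex vec set \<Rightarrow> nat" where
  "cdim N U = vectorspace.dim class_ring ((module_vec TYPE(complex) N)\<lparr>carrier := U\<rparr>)"

definition oproj :: "complex vec set \<Rightarrow> complex vec \<Rightarrow> complex vec" where
  "oproj U x = (THE p. p \<in> U \<and> (\<forall>w\<in>U. (x - p) \<bullet>c w = 0))"

definition norm2 :: "complex vec \<Rightarrow> real" where
  "norm2 x = sqrt (\<Sum>a<dim_vec x. (cmod (x $ a))\<^sup>2)"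

definition coherence :: "nat \<Rightarrow> complex vec set \<Rightarrow> real" where
  "coherence N U =
     real N / real (cdim N U) * (SUP i\<in>{..<N}. (norm2 (oproj U (unit_vec N i)))\<^sup>2)"

text \<open>No order is imposed on the singular values, since nothing below depends on it.\<close>

definition compact_svd ::
  "complex mat \<Rightarrow> nat \<Rightarrow> (nat \<Rightarrow> real) \<Rightarrow> (nat \<Rightarrow> complex vec) \<Rightarrow> (nat \<Rightarrow> complex vec) \<Rightarrow> bool" where
  "compact_svd A r s u v \<longleftrightarrow>
     r = vec_space.rank (dim_row A) A \<and>
     (\<forall>i<r. s i > 0) \<and>
     (\<forall>i<r. u i \<in> carrier_vec (dim_row A) \<and> v i \<in> carrier_vec (dim_col A)) \<and>
     (\<forall>i<r. \<forall>j<r. u i \<bullet>c u j = (if i = j then 1 else 0)) \<and>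
     (\<forall>i<r. \<forall>j<r. v i \<bullet>c v j = (if i = j then 1 else 0)) \<and>
     A = mat (dim_row A) (dim_col A)
           (\<lambda>(a, b). \<Sum>i<r. of_real (s i) * (u i $ a) * cnj (v i $ b))"

text \<open>
  A compact SVD is not unique, but the two spans do not depend on its choice, so \<open>THE\<close> is
  legitimate. For the entrywise bound no uniqueness is presupposed: it is required for every
  compact SVD, together with the existence of one.
\<close>

definition left_space :: "complex mat \<Rightarrow> complex vec set" where
  "left_space A =
     (THE U. \<exists>r s u v. compact_svd A r s u v \<and> U = cspan (dim_row A) (u ` {..<r}))"

definition right_space :: "complex mat \<Rightarrow> complex vec set" where
  "right_space A =
     (THE V. \<exists>r s u v. compact_svd A r s u v \<and> V = cspan (dim_col A) (v ` {..<r}))"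

definition obeys_A0 :: "complex mat \<Rightarrow> real \<Rightarrow> bool" where
  "obeys_A0 A \<mu>0 \<longleftrightarrow> 0 < \<mu>0 \<and>
     max (coherence (dim_row A) (left_space A)) (coherence (dim_col A) (right_space A)) \<le> \<mu>0"

definition max_abs_entry :: "complex mat \<Rightarrow> real" where
  "max_abs_entry A = Max {cmod (A $$ (a, b)) | a b. a < dim_row A \<and> b < dim_col A}"

definition obeys_A1 :: "complex mat \<Rightarrow> real \<Rightarrow> bool" where
  "obeys_A1 A \<mu>1 \<longleftrightarrow> 0 < \<mu>1 \<and>
     (\<exists>r s u v. compact_svd A r s u v) \<and>
     (\<forall>r s u v. compact_svd A r s u v \<longrightarrow>
        max_abs_entry (mat (dim_row A) (dim_col A)
            (\<lambda>(a, b). \<Sum>i<r. (u i $ a) * cnj (v i $ b)))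
          \<le> \<mu>1 * sqrt (real r / (real (dim_row A) * real (dim_col A))))"

definition mu0 :: "nat \<Rightarrow> real \<Rightarrow> nat \<Rightarrow> nat \<Rightarrow> real" where
  "mu0 K x Mr Mt =
     (let f = (\<lambda>M. real M / (real M - (real K - 1) * sqrt (beta x))) in max (f Mt) (f Mr))"

definition mu1 :: "nat \<Rightarrow> real \<Rightarrow> nat \<Rightarrow> nat \<Rightarrow> real" where
  "mu1 K x Mr Mt =
     (let f = (\<lambda>M. real M * sqrt (real K) / (real M - (real K - 1) * sqrt (beta x)))
      in max (f Mt) (f Mr))"

end

theory Submission
  imports Defs "HOL-Real_Asymp.Real_Asymp"
begin

text \<open>
  The supremum \<open>\<beta>\<close> at \<open>x\<close> equals \<open>1/sin\<^sup>2(\<pi> x)\<close>, so \<open>sqrt \<beta>\<close> bounds the Dirichlet kernels that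
  form the off-diagonal entries of the Gram matrices of the two Vandermonde factors. Comparing
  with the diagonal, these Gram matrices are bounded below by \<open>\<delta> = M - (K - 1) sqrt \<beta>\<close>. The singular
  spaces of the data matrix are the ranges of the (conjugated) factors, and a vector of such a
  range is controlled by its coordinate vector through \<open>\<delta>\<close>, so every unit vector projects
  to squared length at most \<open>K/\<delta>\<close>; this gives the coherence bound \<open>M/\<delta>\<close>, and with Cauchy-Schwarz
  the entrywise bound. Since the squared lengths sum to the rank, the coherence is at least \<open>1\<close>,
  and it tends to \<open>1\<close> because \<open>M/\<delta>\<close> does.
\<close>

section \<open>The separation parameter\<close>

text \<open>At given angles the value of \<open>xi\<close> depends on the angles, so
  \<open>1 - cos (\<eta> / 2)\<close> enters as the worst case over all admissible tuples. Besides
  \<open>0 < x \<le> 1/2\<close>, the matrix estimates use a number \<open>x\<close> only through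
  \<open>sin (pi * x) \<le> sin (pi * t)\<close> for every half difference \<open>t\<close> of two
  sines. The worst case and the actual value both satisfy this, so one argument with an unspecified
  \<open>x\<close> covers both. The obstacle in the linear algebra is that the singular spaces and
  the projection are given by \<open>THE\<close>: no coherence can be computed before a compact
  decomposition is known to exist, its spans are known to be independent of the choice, and they are
  identified with ranges of matrices. This is why an existence proof for singular value
  decompositions precedes everything about Vandermonde factors. The threshold
  \<open>K * sqrt (beta x)\<close>, with \<open>K\<close> in place of \<open>K - 1\<close>, leaves a
  margin: \<open>\<delta>\<close> is then at least \<open>sqrt (beta x)\<close>. Positivity of
  \<open>\<delta>\<close> also makes both factors injective, which yields rank exactly
  \<open>K\<close>.\<close>

lemma sin_pi_mono:
  assumes "0 < x" "x \<le> y" "y \<le> 1/2"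
  shows "0 < sin (pi * x)" "sin (pi * x) \<le> sin (pi * y)" "x < y \<Longrightarrow> sin (pi * x) < sin (pi * y)"
proof -
  have y: "pi * y \<le> pi * (1/2)" using assms by (intro mult_left_mono) auto
  have x: "0 < pi * x" using assms by simp
  have "pi * x \<le> pi * y" using assms by (intro mult_left_mono) auto
  with x y have *: "pi * x \<le> pi * y" "pi * y \<le> pi / 2" "- (pi / 2) \<le> pi * x"
      "- (pi / 2) \<le> pi * y" "pi * x \<le> pi / 2"
    using pi_gt_zero by linarith+
  show "0 < sin (pi * x)" using x * pi_gt_zero by (intro sin_gt_zero) linarith+
  show "sin (pi * x) \<le> sin (pi * y)" using * sin_mono_le_eq[of "pi*x" "pi*y"] by linarith
  show "sin (pi * x) < sin (pi * y)" if "x < y"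
  proof -
    have "pi * x < pi * y" using that by simp
    then show ?thesis using * sin_mono_less_eq[of "pi*x" "pi*y"] by linarith
  qed
qed

text \<open>Since \<open>M\<close> is real, \<open>M = 1 / (2 * x)\<close> is allowed. At the left
  endpoint it turns the numerator into \<open>(sin (pi / 2))^2 = 1\<close>, while the denominator is
  smallest there, so both extremes occur together.\<close>

lemma beta_eq:
  assumes "0 < x" "x \<le> 1/2"
  shows "beta x = 1 / (sin (pi * x))\<^sup>2"
  unfolding beta_def
proof (rule cSup_eq_maximum)
  have "pi * (1 / (2 * x)) * x = pi / 2"
    using assms by simp
  then have "1 / (sin (pi * x))\<^sup>2 = (sin (pi * (1 / (2 * x)) * x))\<^sup>2 / (sin (pi * x))\<^sup>2"
    by (simp only: sin_pi_half) simp
  moreover have "x \<in> {x..1/2}" "1 / (2 * x) > 0" using assms by auto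
  ultimately show "1 / (sin (pi * x))\<^sup>2 \<in>
      {(sin (pi * M * y))\<^sup>2 / (sin (pi * y))\<^sup>2 | y M. y \<in> {x..1/2} \<and> M > (0::real)}"
    by blast
next
  fix z assume "z \<in> {(sin (pi * M * y))\<^sup>2 / (sin (pi * y))\<^sup>2 | y M. y \<in> {x..1/2} \<and> M > (0::real)}"
  then obtain y M where z: "z = (sin (pi * M * y))\<^sup>2 / (sin (pi * y))\<^sup>2" and y: "x \<le> y" "y \<le> 1/2"
    by auto
  have pos: "0 < sin (pi * x)" and "sin (pi * x) \<le> sin (pi * y)"
    using sin_pi_mono(1,2)[of x y] assms y by auto
  then have "(sin (pi * x))\<^sup>2 \<le> (sin (pi * y))\<^sup>2" using pos by (intro power_mono) auto
  moreover have "(sin (pi * M * y))\<^sup>2 \<le> 1" by (simp add: abs_square_le_1)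
  ultimately show "z \<le> 1 / (sin (pi * x))\<^sup>2" unfolding z using pos by (intro frac_le) auto
qed

lemma sqrt_beta:
  assumes "0 < x" "x \<le> 1/2"
  shows "sqrt (beta x) = 1 / sin (pi * x)"
  using sin_pi_mono(1)[OF assms(1) order_refl assms(2)]
  by (simp add: beta_eq[OF assms] real_sqrt_divide)

text \<open>\<open>gap\<close> is the distance to the nearest integer; between \<open>0\<close> and
  \<open>1\<close> only these two integers compete.\<close>

lemma gap_eq_min:
  assumes "0 < t" "t < 1"
  shows "gap t = min t (1 - t)"
proof -
  have "\<lceil>t\<rceil> = 1" "\<lfloor>t\<rfloor> = 0" using assms by linarith+
  then show ?thesis by (auto simp: gap_def min_def)
qed

text \<open>Sum-to-product gives \<open>t = sin (d / 2) * \<bar>cos ((x + y) / 2)\<bar>\<close>. The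
  upper bound drops the cosine. For the lower bound the cosine is at least
  \<open>sin (d / 2)\<close>, so \<open>t\<close> is at least the square of
  \<open>sin (\<eta> / 2)\<close>, which is \<open>1 - cos (\<eta> / 2)\<close> times a factor at
  least \<open>1\<close>. The sharp side is the upper one; the lower bound is chosen to be its
  mirror image under \<open>t \<mapsto> 1 - t\<close>.\<close>

lemma half_sin_diff_bounds:
  assumes "(x, y) \<in> angle_region \<eta>" "0 < \<eta>" "\<eta> \<le> pi / 2"
  defines "t \<equiv> 1 / 2 * \<bar>sin x - sin y\<bar>"
  shows "1 - cos (\<eta> / 2) \<le> t" "t \<le> cos (\<eta> / 2)"
proof -
  define d where "d = \<bar>y - x\<bar>"
  have x: "- pi / 2 \<le> x" "x \<le> pi / 2" and y: "- pi / 2 \<le> y" "y \<le> pi / 2"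
    and d: "\<eta> \<le> d" "d \<le> pi - \<eta>"
    using assms(1) by (auto simp: angle_region_def d_def)
  have t: "t = sin (d / 2) * \<bar>cos ((x + y) / 2)\<bar>"
  proof -
    have s0: "0 \<le> sin (d / 2)" using d assms by (intro sin_ge_zero) auto
    have "\<bar>sin ((x - y) / 2)\<bar> = \<bar>sin (d / 2)\<bar>"
    proof (cases "x \<le> y")
      case True
      then have "(x - y) / 2 = - (d / 2)" by (simp add: d_def field_simps)
      then show ?thesis by (simp only: sin_minus abs_minus)
    qed (simp add: d_def)
    then show ?thesis using s0 by (simp add: t_def sin_diff_sin abs_mult)
  qed
  have s1: "sin (\<eta> / 2) \<le> sin (d / 2)" "sin (d / 2) \<le> sin ((pi - \<eta>) / 2)" 
    using d assms(2,3) by (subst sin_mono_le_eq; auto)+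
  have c: "sin ((pi - \<eta>) / 2) = cos (\<eta> / 2)" by (simp add: diff_divide_distrib sin_diff)
  have s0: "0 \<le> sin (\<eta> / 2)" using assms by (intro sin_ge_zero) auto
  have c0: "0 \<le> cos (\<eta> / 2)" using assms by (intro cos_ge_zero) auto
  have "t \<le> sin (d / 2) * 1" unfolding t using s0 s1 by (intro mult_left_mono) auto
  then show "t \<le> cos (\<eta> / 2)" using s1 c by simp
  \<comment> \<open>The sum of \<open>\<bar>x + y\<bar>\<close> and \<open>\<bar>x - y\<bar>\<close>
    is twice the larger of \<open>\<bar>x\<bar>\<close> and \<open>\<bar>y\<bar>\<close>, hence at
    most \<open>pi\<close>.\<close>
  have "\<bar>x + y\<bar> \<le> pi - d" unfolding d_def using x y by (auto simp: abs_if)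
  then have "\<bar>(x + y) / 2\<bar> \<le> pi / 2 - d / 2" by (simp add: field_simps)
  moreover have "0 \<le> \<bar>(x + y) / 2\<bar>" "pi / 2 - d / 2 \<le> pi" using d assms by auto
  ultimately have "cos (pi / 2 - d / 2) \<le> cos \<bar>(x + y) / 2\<bar>" by (intro cos_monotone_0_pi_le) auto
  then have "sin (d / 2) \<le> cos ((x + y) / 2)" by (simp only: cos_abs_real) (simp add: cos_diff)
  then have "sin (d / 2) \<le> \<bar>cos ((x + y) / 2)\<bar>" by linarith
  then have "sin (\<eta> / 2) * sin (\<eta> / 2) \<le> t" unfolding t using s0 s1 by (intro mult_mono) auto
  moreover have "sin (\<eta> / 2) * sin (\<eta> / 2) = (1 - cos (\<eta> / 2)) * (1 + cos (\<eta> / 2))"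
    using sin_cos_squared_add[of "\<eta> / 2"] by (simp add: power2_eq_square algebra_simps)
  moreover have "(1 - cos (\<eta> / 2)) * 1 \<le> (1 - cos (\<eta> / 2)) * (1 + cos (\<eta> / 2))"
    using c0 by (intro mult_left_mono) auto
  ultimately show "1 - cos (\<eta> / 2) \<le> t" by simp
qed

lemma xi_least_bounds:
  fixes \<eta> :: real
  assumes "0 < \<eta>" "\<eta> \<le> pi / 2"
  shows "0 < 1 - cos (\<eta> / 2)" "1 - cos (\<eta> / 2) \<le> (2 - sqrt 2) / 2" "1 - cos (\<eta> / 2) < 1/2"
proof -
  have "cos (\<eta> / 2) < cos 0" using assms by (subst cos_mono_less_eq) auto
  then show "0 < 1 - cos (\<eta> / 2)" by simp
  have "cos (pi / 4) \<le> cos (\<eta> / 2)" using assms by (subst cos_mono_le_eq) auto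
  then show *: "1 - cos (\<eta> / 2) \<le> (2 - sqrt 2) / 2" by (simp add: cos_45 field_simps)
  have "1 < sqrt (2 :: real)" by simp
  also have "\<dots> \<le> cos (\<eta> / 2) * 2" using * by (simp add: field_simps)
  finally show "1 - cos (\<eta> / 2) < 1/2" by linarith
qed

text \<open>The interval from \<open>1 - cos (\<eta> / 2)\<close> to \<open>cos (\<eta> / 2)\<close>
  is symmetric about \<open>1/2\<close>, so folding \<open>t\<close> to \<open>min t (1 - t)\<close>
  keeps the lower bound. The sine of \<open>pi * t\<close> is invariant under this folding, which
  lets a kernel at \<open>t\<close> be compared with \<open>beta\<close> at a gap.\<close>

lemma gap_bounds:
  assumes "(x, y) \<in> angle_region \<eta>" "0 < \<eta>" "\<eta> \<le> pi / 2"
  defines "t \<equiv> 1 / 2 * \<bar>sin x - sin y\<bar>"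
  shows "0 < t" "t < 1" "1 - cos (\<eta> / 2) \<le> gap t" "gap t \<le> 1/2"
    "sin (pi * gap t) = sin (pi * t)"
proof -
  note b = half_sin_diff_bounds[OF assms(1-3), folded t_def]
  note e = xi_least_bounds[OF assms(2,3)]
  show t: "0 < t" "t < 1" using b e by linarith+
  show "1 - cos (\<eta> / 2) \<le> gap t" using b by (simp add: gap_eq_min[OF t])
  show "gap t \<le> 1/2" by (cases "t \<le> 1/2") (auto simp: gap_eq_min[OF t] min_le_iff_disj)
  have "sin (pi * (1 - t)) = sin (pi * t)" by (simp add: right_diff_distrib sin_diff)
  then show "sin (pi * gap t) = sin (pi * t)" by (simp add: gap_eq_min[OF t] min_def)
qed

lemma xi_half_wavelength:
  assumes "lam > 0"
  shows "xi lam (lam / 2) (lam / 2) K \<phi> =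
    Min {gap (1 / 2 * \<bar>sin (\<phi> i) - sin (\<phi> j)\<bar>) | i j. i < K \<and> j < K \<and> i \<noteq> j}"
  using assms by (simp add: xi_def xi_one_def)

lemma finite_index_pairs:
  "finite {f i j | i j :: nat. i < K \<and> j < K \<and> i \<noteq> j}"
proof -
  have "{f i j | i j. i < K \<and> j < K \<and> i \<noteq> j} \<subseteq> (\<lambda>(i, j). f i j) ` ({..<K} \<times> {..<K})" by auto
  then show ?thesis by (rule finite_subset) auto
qed

lemma xi_le_gap:
  assumes "lam > 0" "i < K" "j < K" "i \<noteq> j"
  shows "xi lam (lam / 2) (lam / 2) K \<phi> \<le> gap (1 / 2 * \<bar>sin (\<phi> i) - sin (\<phi> j)\<bar>)"
  unfolding xi_half_wavelength[OF assms(1)] by (rule Min_le[OF finite_index_pairs]) (use assms in blast)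

lemma xi_mem:
  assumes "lam > 0" "2 \<le> K"
  obtains i j where "i < K" "j < K" "i \<noteq> j"
    "xi lam (lam / 2) (lam / 2) K \<phi> = gap (1 / 2 * \<bar>sin (\<phi> i) - sin (\<phi> j)\<bar>)"
proof -
  have "0 < K" "1 < K" "0 \<noteq> (1::nat)" using assms(2) by auto
  then have ne: "{gap (1 / 2 * \<bar>sin (\<phi> i) - sin (\<phi> j)\<bar>) | i j. i < K \<and> j < K \<and> i \<noteq> j} \<noteq> {}" by blast
  show ?thesis using that Min_in[OF finite_index_pairs ne] unfolding xi_half_wavelength[OF assms(1)] by auto
qed

lemma xi_ge:
  assumes "lam > 0" "2 \<le> K" "admissible \<eta> K \<phi>" "0 < \<eta>" "\<eta> \<le> pi / 2"
  shows "1 - cos (\<eta> / 2) \<le> xi lam (lam / 2) (lam / 2) K \<phi>"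
    and "xi lam (lam / 2) (lam / 2) K \<phi> \<le> 1/2"
proof -
  obtain i j where "i < K" "j < K" "i \<noteq> j"
    "xi lam (lam / 2) (lam / 2) K \<phi> = gap (1 / 2 * \<bar>sin (\<phi> i) - sin (\<phi> j)\<bar>)"
    by (rule xi_mem[OF assms(1,2)])
  then show "1 - cos (\<eta> / 2) \<le> xi lam (lam / 2) (lam / 2) K \<phi>"
      "xi lam (lam / 2) (lam / 2) K \<phi> \<le> 1/2"
    using gap_bounds[of "\<phi> i" "\<phi> j" \<eta>] assms(3-5) by (auto simp: admissible_def)
qed

text \<open>The value is attained by two angles symmetric about \<open>0\<close> at the largest admissible distance:
  shift the given angles until the smallest is \<open>-(\<pi> - \<eta>)/2\<close>, then move the largest to
  \<open>(\<pi> - \<eta>)/2\<close>, which only increases its distance to the others.\<close>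

lemma xi_attained:
  assumes "lam > 0" "2 \<le> K" "admissible \<eta> K \<phi>" "0 < \<eta>" "\<eta> \<le> pi / 2"
  shows "\<exists>\<psi>. admissible \<eta> K \<psi> \<and> xi lam (lam / 2) (lam / 2) K \<psi> = 1 - cos (\<eta> / 2)"
proof -
  have fin: "finite (\<phi> ` {..<K})" "\<phi> ` {..<K} \<noteq> {}" using assms(2) by (auto simp: lessThan_empty_iff)
  obtain m where m: "m < K" "\<phi> m = Min (\<phi> ` {..<K})" using Min_in[OF fin] by auto
  obtain l where l: "l < K" "\<phi> l = Max (\<phi> ` {..<K})" using Max_in[OF fin] by auto
  have mi: "\<phi> m \<le> \<phi> i" if "i < K" for i using that m fin by simp
  have li: "\<phi> i \<le> \<phi> l" if "i < K" for i using that l fin by simp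
  have adm: "\<eta> \<le> \<bar>\<phi> j - \<phi> i\<bar>" "\<bar>\<phi> j - \<phi> i\<bar> \<le> pi - \<eta>" if "i < K" "j < K" "i \<noteq> j" for i j
    using assms(3) that by (auto simp: admissible_def angle_region_def)
  have ml: "m \<noteq> l"
  proof
    assume "m = l"
    then have "\<phi> 0 = \<phi> 1" using mi[of 0] li[of 0] mi[of 1] li[of 1] assms(2) by auto
    then show False using adm[of 0 1] assms by auto
  qed
  define h where "h = (pi - \<eta>) / 2"
  define \<psi> where "\<psi> i = (if i = l then h else \<phi> i - \<phi> m - h)" for i
  have h2: "2 * h = pi - \<eta>" by (simp add: h_def)
  have h0: "0 < h" "h \<le> pi / 2" using h2 assms(4,5) pi_gt_zero by linarith+
  have lm: "\<eta> \<le> \<phi> l - \<phi> m" "\<phi> l - \<phi> m \<le> 2 * h" using adm[of m l] m l ml mi[of l] by (auto simp: h2)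
  have rng: "- h \<le> \<psi> i" "\<psi> i \<le> h" if "i < K" for i
    using mi[OF that] li[OF that] lm h0 by (auto simp: \<psi>_def)
  have far: "\<eta> \<le> \<bar>\<psi> j - \<psi> i\<bar>" if "i < K" "j < K" "i \<noteq> j" for i j
  proof -
    have "\<bar>\<phi> j - \<phi> i\<bar> \<le> \<bar>\<psi> j - \<psi> i\<bar>"
      using that li[of i] li[of j] mi[of i] mi[of j] lm by (auto simp: \<psi>_def)
    then show ?thesis using adm[OF that] by linarith
  qed
  have adm': "admissible \<eta> K \<psi>"
    unfolding admissible_def
  proof (intro allI impI)
    fix i j assume ij: "i < K" "j < K" "i \<noteq> j"
    show "(\<psi> i, \<psi> j) \<in> angle_region \<eta>"
      using rng[OF ij(1)] rng[OF ij(2)] far[OF ij] h0 h2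
      by (simp add: angle_region_def abs_le_iff)
  qed
  have hs: "sin h = cos (\<eta> / 2)" by (simp add: h_def diff_divide_distrib sin_diff)
  have "\<psi> l = h" "\<psi> m = - h" using ml by (auto simp: \<psi>_def)
  moreover have "0 < cos (\<eta> / 2)" using assms by (intro cos_gt_zero) auto
  ultimately have t: "1 / 2 * \<bar>sin (\<psi> l) - sin (\<psi> m)\<bar> = cos (\<eta> / 2)" by (simp add: hs)
  have "xi lam (lam / 2) (lam / 2) K \<psi> \<le> gap (cos (\<eta> / 2))"
    using xi_le_gap[OF assms(1) l(1) m(1) ml[symmetric], of \<psi>] t by simp
  also have "\<dots> = 1 - cos (\<eta> / 2)"
    using xi_least_bounds[OF assms(4,5)] by (subst gap_eq_min) auto
  finally show ?thesis using xi_ge(1)[OF assms(1,2) adm' assms(4,5)] adm' by force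
qed

section \<open>Existence of singular value decompositions\<close>

lemma trace_mult_comm:
  fixes A B :: "'a :: comm_ring_1 mat"
  assumes "A \<in> carrier_mat n m" "B \<in> carrier_mat m n"
  shows "(\<Sum>i<n. (A * B) $$ (i, i)) = (\<Sum>i<m. (B * A) $$ (i, i))"
proof -
  have "(\<Sum>i<n. (A * B) $$ (i, i)) = (\<Sum>i<n. \<Sum>j<m. A $$ (i, j) * B $$ (j, i))"
    using assms by (intro sum.cong) (auto simp: scalar_prod_def atLeast0LessThan)
  also have "\<dots> = (\<Sum>j<m. \<Sum>i<n. B $$ (j, i) * A $$ (i, j))"
    by (subst sum.swap) (simp add: mult.commute)
  also have "\<dots> = (\<Sum>j<m. (B * A) $$ (j, j))"
    using assms by (intro sum.cong) (auto simp: scalar_prod_def atLeast0LessThan)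
  finally show ?thesis .
qed

lemma trace_similar_mat:
  fixes A B :: "'a :: comm_ring_1 mat"
  assumes "A \<in> carrier_mat n n" "similar_mat A B"
  shows "(\<Sum>i<n. A $$ (i, i)) = (\<Sum>i<n. B $$ (i, i))"
proof -
  obtain P Q where "similar_mat_wit A B P Q" using assms(2) by (auto simp: similar_mat_def)
  note w = similar_mat_witD2[OF assms(1) this]
  have "(\<Sum>i<n. (P * B * Q) $$ (i, i)) = (\<Sum>i<n. (Q * (P * B)) $$ (i, i))"
    using w by (intro trace_mult_comm) auto
  also have "Q * (P * B) = B" using w assoc_mult_mat[of Q n n P n B n] by auto
  finally show ?thesis using w by simp
qed

text \<open>The Schur triangular form has the same trace, so one of its diagonal entries is nonzero;
  these entries are the roots of the characteristic polynomial.\<close>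

lemma nonzero_eigenvalue_of_trace:
  fixes B :: "complex mat"
  assumes B: "B \<in> carrier_mat m m" and tr: "(\<Sum>i<m. B $$ (i, i)) \<noteq> 0"
  obtains l where "l \<noteq> 0" "eigenvalue B l"
proof -
  obtain es where es: "char_poly B = (\<Prod>e\<leftarrow>es. [:- e, 1:])" using char_poly_factorized[OF B] by auto
  define T where "T = schur_upper_triangular B es"
  note T = schur_upper_triangular[OF B es, folded T_def]
  have "(\<Sum>i<m. T $$ (i, i)) \<noteq> 0" using tr trace_similar_mat[OF B T(3)] by simp
  then have "\<exists>i<m. T $$ (i, i) \<noteq> 0" by (rule contrapos_np) simp
  then obtain i where i: "i < m" "T $$ (i, i) \<noteq> 0" by blast
  have "T $$ (i, i) \<in> set (diag_mat T)" using i T(1) by (auto simp: diag_mat_def)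
  then have "poly (char_poly T) (T $$ (i, i)) = 0"
    unfolding char_poly_upper_triangular[OF T(1,2)] by (rule linear_poly_root)
  then have "eigenvalue B (T $$ (i, i))"
    using char_poly_similar[OF T(3)] eigenvalue_root_char_poly[OF B] by simp
  with i(2) show ?thesis by (rule that)
qed

lemma sum_mult_cnj_self: "(\<Sum>a\<in>S. f a * cnj (f a)) = of_real (\<Sum>a\<in>S. (cmod (f a))\<^sup>2)"
  by (simp only: of_real_sum complex_norm_square)

text \<open>The trace of \<open>A^H A\<close> is the sum of all squared moduli, hence positive.
  Pairing the eigenvalue equation with the eigenvector \<open>z\<close> gives
  \<open>l |z|^2 = |A z|^2\<close>, so the nonzero eigenvalue is real and positive; rescaling
  \<open>z\<close> finishes.\<close>

lemma gram_eigenvector: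
  fixes A :: "nat \<Rightarrow> nat \<Rightarrow> complex"
  assumes "a0 < n" "b0 < m" "A a0 b0 \<noteq> 0"
  obtains l x where "0 < l" "(\<Sum>b<m. (cmod (x b))\<^sup>2) = 1"
    "\<And>b. b < m \<Longrightarrow> (\<Sum>a<n. cnj (A a b) * (\<Sum>c<m. A a c * x c)) = of_real l * x b"
proof -
  define B where "B = mat m m (\<lambda>(b, c). \<Sum>a<n. cnj (A a b) * A a c)"
  have B: "B \<in> carrier_mat m m" by (simp add: B_def)
  define S where "S = (\<Sum>b<m. \<Sum>a<n. (cmod (A a b))\<^sup>2)"
  have "(\<Sum>b<m. B $$ (b, b)) = of_real S"
    by (simp add: B_def S_def complex_norm_square mult.commute del: of_real_power)
  moreover have "0 < S"
    unfolding S_def using assms by (intro sum_pos2[of _ b0] sum_pos2[of _ a0]) (auto intro: sum_nonneg)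
  ultimately have "(\<Sum>b<m. B $$ (b, b)) \<noteq> 0" by simp
  then obtain l where l: "l \<noteq> 0" "eigenvalue B l" by (rule nonzero_eigenvalue_of_trace[OF B])
  then obtain z where z: "z \<in> carrier_vec m" "z \<noteq> 0\<^sub>v m" "B *\<^sub>v z = l \<cdot>\<^sub>v z"
    using B by (auto simp: eigenvalue_def eigenvector_def)
  define y where "y a = (\<Sum>c<m. A a c * z $ c)" for a
  have ev: "(\<Sum>a<n. cnj (A a b) * y a) = l * z $ b" if "b < m" for b
  proof -
    have "(B *\<^sub>v z) $ b = (\<Sum>c<m. (\<Sum>a<n. cnj (A a b) * A a c) * z $ c)"
      using that z(1) by (simp add: B_def scalar_prod_def atLeast0LessThan)
    also have "\<dots> = (\<Sum>a<n. cnj (A a b) * y a)"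
      by (simp add: sum_distrib_left sum_distrib_right y_def mult.assoc) (rule sum.swap)
    finally show ?thesis using z that by simp
  qed
  define Nz where "Nz = (\<Sum>b<m. (cmod (z $ b))\<^sup>2)"
  define Ny where "Ny = (\<Sum>a<n. (cmod (y a))\<^sup>2)"
  obtain b1 where "b1 < m" "z $ b1 \<noteq> 0" using z by (metis carrier_vecD eq_vecI index_zero_vec)
  then have Nz: "0 < Nz" unfolding Nz_def by (intro sum_pos2[of _ b1]) auto
  have "l * of_real Nz = (\<Sum>b<m. cnj (z $ b) * (l * z $ b))"
    unfolding Nz_def sum_mult_cnj_self[symmetric] by (simp add: sum_distrib_left mult_ac)
  also have "\<dots> = (\<Sum>b<m. cnj (z $ b) * (\<Sum>a<n. cnj (A a b) * y a))" using ev by simp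
  also have "\<dots> = (\<Sum>a<n. y a * cnj (y a))"
    unfolding sum_distrib_left by (subst sum.swap) (simp add: y_def[of "_ :: nat"] sum_distrib_left mult_ac)
  also have "\<dots> = of_real Ny" by (simp add: sum_mult_cnj_self Ny_def)
  finally have lr: "l = of_real (Ny / Nz)" using Nz by (simp add: field_simps)
  have "0 \<le> Ny" unfolding Ny_def by (intro sum_nonneg) auto
  then have lpos: "0 < Ny / Nz" using l(1) lr Nz by (cases "Ny = 0") auto
  show ?thesis
  proof (rule that[of "Ny / Nz" "\<lambda>b. z $ b / of_real (sqrt Nz)"])
    show "(\<Sum>b<m. (cmod (z $ b / of_real (sqrt Nz)))\<^sup>2) = 1"
      using Nz by (simp add: norm_divide power_divide sum_divide_distrib[symmetric] flip: Nz_def)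
    fix b assume "b < m"
    have "(\<Sum>a<n. cnj (A a b) * (\<Sum>c<m. A a c * (z $ c / of_real (sqrt Nz))))
        = (\<Sum>a<n. cnj (A a b) * y a) / of_real (sqrt Nz)"
      by (simp add: y_def sum_divide_distrib sum_distrib_left)
    then show "(\<Sum>a<n. cnj (A a b) * (\<Sum>c<m. A a c * (z $ c / of_real (sqrt Nz))))
        = of_real (Ny / Nz) * (z $ b / of_real (sqrt Nz))"
      using ev[OF \<open>b < m\<close>] lr by simp
  qed (rule lpos)
qed

section \<open>Orthonormal families: Parseval identity, Bessel inequality, extension\<close>

definition orthonormal_family :: "nat \<Rightarrow> nat \<Rightarrow> (nat \<Rightarrow> nat \<Rightarrow> complex) \<Rightarrow> bool" where
  "orthonormal_family n k u \<longleftrightarrow>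
     (\<forall>i<k. \<forall>j<k. (\<Sum>a<n. u i a * cnj (u j a)) = (if i = j then 1 else 0))"

text \<open>The Gram expansion is stated for arbitrary families because it serves twice: for
  orthonormal ones, and for the columns of a factor whose Gram matrix is only nearly
  diagonal.\<close>

lemma norm_combination:
  fixes u :: "nat \<Rightarrow> nat \<Rightarrow> complex"
  shows "of_real (\<Sum>a<n. (cmod (\<Sum>i<k. c i * u i a))\<^sup>2) =
    (\<Sum>i<k. \<Sum>j<k. c i * cnj (c j) * (\<Sum>a<n. u i a * cnj (u j a)))"
proof -
  have "of_real (\<Sum>a<n. (cmod (\<Sum>i<k. c i * u i a))\<^sup>2)
      = (\<Sum>a<n. (\<Sum>i<k. c i * u i a) * cnj (\<Sum>j<k. c j * u j a))"
    by (simp only: sum_mult_cnj_self)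
  also have "\<dots> = (\<Sum>a<n. \<Sum>i<k. \<Sum>j<k. c i * cnj (c j) * (u i a * cnj (u j a)))"
    by (simp add: sum_product mult_ac)
  also have "\<dots> = (\<Sum>i<k. \<Sum>j<k. c i * cnj (c j) * (\<Sum>a<n. u i a * cnj (u j a)))"
    unfolding sum_distrib_left by (subst sum.swap, rule sum.cong[OF refl], rule sum.swap)
  finally show ?thesis .
qed

lemma orthonormal_family_norm:
  assumes "orthonormal_family n k u"
  shows "(\<Sum>a<n. (cmod (\<Sum>i<k. c i * u i a))\<^sup>2) = (\<Sum>i<k. (cmod (c i))\<^sup>2)"
proof -
  have "of_real (\<Sum>a<n. (cmod (\<Sum>i<k. c i * u i a))\<^sup>2)
      = (\<Sum>i<k. \<Sum>j<k. if i = j then c i * cnj (c j) else 0)"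
    unfolding norm_combination using assms by (intro sum.cong) (auto simp: orthonormal_family_def)
  also have "\<dots> = (\<Sum>i<k. c i * cnj (c i))" by simp
  also have "\<dots> = of_real (\<Sum>i<k. (cmod (c i))\<^sup>2)" by (rule sum_mult_cnj_self)
  finally show ?thesis by (simp only: of_real_eq_iff)
qed

lemma orthonormal_family_total:
  assumes "orthonormal_family n k u"
  shows "(\<Sum>a<n. \<Sum>i<k. (cmod (u i a))\<^sup>2) = real k"
proof -
  have "(\<Sum>a<n. (cmod (u i a))\<^sup>2) = 1" if "i < k" for i
  proof -
    have "of_real (\<Sum>a<n. (cmod (u i a))\<^sup>2) = (1 :: complex)"
      using assms that by (simp only: sum_mult_cnj_self[symmetric]) (simp add: orthonormal_family_def)
    then show ?thesis by (simp only: of_real_eq_1_iff)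
  qed
  then show ?thesis by (subst sum.swap) simp
qed

text \<open>The projection of the \<open>a\<close>-th unit vector has squared norm \<open>t\<close>
  and \<open>a\<close>-th entry \<open>t\<close>, so \<open>t^2 \<le> t\<close> and
  \<open>t \<le> 1\<close>. Summing over the \<open>n\<close> rows compares the total
  \<open>k\<close> with \<open>n\<close>.\<close>

lemma orthonormal_family_card_le:
  assumes "orthonormal_family n k u"
  shows "k \<le> n"
proof -
  have "(\<Sum>i<k. (cmod (u i a))\<^sup>2) \<le> 1" if "a < n" for a
  proof -
    define t where "t = (\<Sum>i<k. (cmod (u i a))\<^sup>2)"
    have t: "(\<Sum>i<k. cnj (u i a) * u i a) = of_real t"
      unfolding t_def sum_mult_cnj_self[symmetric] by (simp add: mult.commute)
    have "t\<^sup>2 = (cmod (\<Sum>i<k. cnj (u i a) * u i a))\<^sup>2" by (simp add: t)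
    also have "\<dots> \<le> (\<Sum>b<n. (cmod (\<Sum>i<k. cnj (u i a) * u i b))\<^sup>2)"
      using that by (intro member_le_sum) auto
    also have "\<dots> = t" by (simp add: orthonormal_family_norm[OF assms] t_def)
    finally have "t * t \<le> 1 * t" by (simp add: power2_eq_square)
    then have "t \<le> 1" by (cases "0 < t") (auto simp: mult_le_cancel_right)
    then show ?thesis by (simp add: t_def)
  qed
  then have "(\<Sum>a<n. \<Sum>i<k. (cmod (u i a))\<^sup>2) \<le> (\<Sum>a<n. 1)" by (intro sum_mono) auto
  then show ?thesis by (simp add: orthonormal_family_total[OF assms])
qed

lemma orthonormal_family_extend:
  assumes "orthonormal_family n k u" "(\<Sum>a<n. (cmod (x a))\<^sup>2) = 1"
    "\<And>i. i < k \<Longrightarrow> (\<Sum>a<n. x a * cnj (u i a)) = 0"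
  shows "orthonormal_family n (Suc k) (u(k := x))"
proof -
  have "(\<Sum>a<n. u i a * cnj (x a)) = 0" if "i < k" for i
  proof -
    have "(\<Sum>a<n. u i a * cnj (x a)) = cnj (\<Sum>a<n. x a * cnj (u i a))" by (simp add: mult.commute)
    then show ?thesis using assms(3)[OF that] by simp
  qed
  moreover have "(\<Sum>a<n. x a * cnj (x a)) = 1" by (simp only: sum_mult_cnj_self assms(2)) simp
  ultimately show ?thesis
    using assms(1,3) by (auto simp: orthonormal_family_def less_Suc_eq)
qed

text \<open>A partial decomposition whose residual \<open>R\<close> is nonzero can be extended: \<open>R\<^sup>H R\<close> has nonzero
  trace, hence a nonzero eigenvalue, and an eigenvector is orthogonal to the vectors found so far
  because \<open>R\<close> annihilates them from both sides. Bessel's inequality bounds the number of terms, so a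
  partial decomposition of maximal length is complete.\<close>

definition svd_residual ::
  "(nat \<Rightarrow> nat \<Rightarrow> complex) \<Rightarrow> nat \<Rightarrow> (nat \<Rightarrow> real) \<Rightarrow> (nat \<Rightarrow> nat \<Rightarrow> complex) \<Rightarrow> (nat \<Rightarrow> nat \<Rightarrow> complex) \<Rightarrow>
    nat \<Rightarrow> nat \<Rightarrow> complex" where
  "svd_residual A k s u v a b = A a b - (\<Sum>i<k. of_real (s i) * u i a * cnj (v i b))"

definition partial_svd ::
  "nat \<Rightarrow> nat \<Rightarrow> (nat \<Rightarrow> nat \<Rightarrow> complex) \<Rightarrow> nat \<Rightarrow> (nat \<Rightarrow> real) \<Rightarrow> (nat \<Rightarrow> nat \<Rightarrow> complex) \<Rightarrow>
    (nat \<Rightarrow> nat \<Rightarrow> complex) \<Rightarrow> bool" where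
  "partial_svd n m A k s u v \<longleftrightarrow>
     (\<forall>i<k. 0 < s i) \<and> orthonormal_family n k u \<and> orthonormal_family m k v \<and>
     (\<forall>i<k. \<forall>a<n. (\<Sum>b<m. svd_residual A k s u v a b * v i b) = 0) \<and>
     (\<forall>i<k. \<forall>b<m. (\<Sum>a<n. cnj (svd_residual A k s u v a b) * u i a) = 0)"

lemma partial_svd_extend:
  assumes "partial_svd n m A k s u v"
    and nz: "a0 < n" "b0 < m" "svd_residual A k s u v a0 b0 \<noteq> 0"
  shows "\<exists>s u v. partial_svd n m A (Suc k) s u v"
proof -
  define R where "R = svd_residual A k s u v"
  have s: "\<And>i. i < k \<Longrightarrow> 0 < s i" and u: "orthonormal_family n k u" and v: "orthonormal_family m k v"
    and Rv: "\<And>i a. i < k \<Longrightarrow> a < n \<Longrightarrow> (\<Sum>b<m. R a b * v i b) = 0"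
    and Ru: "\<And>i b. i < k \<Longrightarrow> b < m \<Longrightarrow> (\<Sum>a<n. cnj (R a b) * u i a) = 0"
    using assms(1) by (auto simp: partial_svd_def R_def)
  obtain l x where l: "0 < l" and x: "(\<Sum>b<m. (cmod (x b))\<^sup>2) = 1"
    and ev: "\<And>b. b < m \<Longrightarrow> (\<Sum>a<n. cnj (R a b) * (\<Sum>c<m. R a c * x c)) = of_real l * x b"
    using gram_eigenvector[OF nz(1,2), of "R"] nz(3) unfolding R_def by blast
  \<comment> \<open>The new left vector is the image of \<open>x\<close> scaled to length
    \<open>1\<close>; the factor \<open>sqrt l\<close> becomes the new singular value.\<close>
  define w where "w a = (\<Sum>c<m. R a c * x c) / of_real (sqrt l)" for a
  have sl: "complex_of_real (sqrt l) \<noteq> 0" "complex_of_real (sqrt l) * complex_of_real (sqrt l) = of_real l"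
    using l by (simp_all flip: of_real_mult)
  have Rx: "(\<Sum>c<m. R a c * x c) = of_real (sqrt l) * w a" for a
    using sl by (simp add: w_def)
  have Rw: "(\<Sum>a<n. cnj (R a b) * w a) = of_real (sqrt l) * x b" if "b < m" for b
  proof -
    have "of_real (sqrt l) * (\<Sum>a<n. cnj (R a b) * w a) = of_real l * x b"
      using ev[OF that, unfolded Rx] by (simp add: sum_distrib_left mult_ac)
    also have "\<dots> = of_real (sqrt l) * (of_real (sqrt l) * x b)" by (simp add: sl(2) flip: mult.assoc)
    finally show ?thesis using sl(1) by simp
  qed
  have wu: "(\<Sum>a<n. w a * cnj (u i a)) = 0" if "i < k" for i
  proof -
    have "of_real (sqrt l) * (\<Sum>a<n. w a * cnj (u i a)) = (\<Sum>a<n. (\<Sum>c<m. R a c * x c) * cnj (u i a))"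
      unfolding Rx by (simp add: sum_distrib_left mult_ac)
    also have "\<dots> = (\<Sum>c<m. x c * cnj (\<Sum>a<n. cnj (R a c) * u i a))"
      by (simp add: sum_distrib_left sum_distrib_right mult_ac) (rule sum.swap)
    also have "\<dots> = 0" using Ru[OF that] by simp
    finally show ?thesis using sl(1) by simp
  qed
  have xv: "(\<Sum>b<m. x b * cnj (v i b)) = 0" if "i < k" for i
  proof -
    have "of_real (sqrt l) * (\<Sum>b<m. x b * cnj (v i b)) = (\<Sum>b<m. (of_real (sqrt l) * x b) * cnj (v i b))"
      by (simp add: sum_distrib_left mult_ac)
    also have "\<dots> = (\<Sum>b<m. (\<Sum>a<n. cnj (R a b) * w a) * cnj (v i b))"
      by (simp add: Rw)
    also have "\<dots> = (\<Sum>a<n. w a * cnj (\<Sum>b<m. R a b * v i b))"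
      by (simp add: sum_distrib_left sum_distrib_right mult_ac) (rule sum.swap)
    also have "\<dots> = 0" using Rv[OF that] by simp
    finally show ?thesis using sl(1) by simp
  qed
  have xx: "(\<Sum>b<m. x b * cnj (x b)) = 1" by (simp only: sum_mult_cnj_self x) simp
  \<comment> \<open>Moving \<open>R\<close> to the other side of the inner product trades the norm
    of \<open>w\<close> for that of \<open>x\<close>, which is \<open>1\<close>.\<close>
  have "of_real (sqrt l) * (\<Sum>a<n. w a * cnj (w a)) = (\<Sum>a<n. (\<Sum>c<m. R a c * x c) * cnj (w a))"
    unfolding Rx by (simp add: sum_distrib_left mult_ac)
  also have "\<dots> = (\<Sum>c<m. x c * cnj (\<Sum>a<n. cnj (R a c) * w a))"
    by (simp add: sum_distrib_left sum_distrib_right mult_ac) (rule sum.swap)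
  also have "\<dots> = (\<Sum>c<m. of_real (sqrt l) * (x c * cnj (x c)))"
    by (intro sum.cong refl) (simp only: lessThan_iff Rw, simp add: mult_ac)
  also have "\<dots> = of_real (sqrt l)" by (simp add: xx flip: sum_distrib_left)
  finally have ww: "(\<Sum>a<n. w a * cnj (w a)) = 1" using sl(1) by simp
  then have w: "(\<Sum>a<n. (cmod (w a))\<^sup>2) = 1" by (simp only: sum_mult_cnj_self of_real_eq_1_iff)
  define R' where "R' = svd_residual A (Suc k) (s(k := sqrt l)) (u(k := w)) (v(k := x))"
  have R': "R' a b = R a b - of_real (sqrt l) * w a * cnj (x b)" for a b
    by (simp add: R'_def R_def svd_residual_def)
  have vx: "(\<Sum>b<m. v i b * cnj (x b)) = 0" if "i < k" for i
  proof -
    have "(\<Sum>b<m. v i b * cnj (x b)) = cnj (\<Sum>b<m. x b * cnj (v i b))" by (simp add: mult.commute)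
    then show ?thesis using xv[OF that] by simp
  qed
  have uw: "(\<Sum>a<n. u i a * cnj (w a)) = 0" if "i < k" for i
  proof -
    have "(\<Sum>a<n. u i a * cnj (w a)) = cnj (\<Sum>a<n. w a * cnj (u i a))" by (simp add: mult.commute)
    then show ?thesis using wu[OF that] by simp
  qed
  \<comment> \<open>The new residual differs by a rank-one term. On the earlier vectors this term
    vanishes by orthogonality, and on the new pair it cancels the action of \<open>R\<close>, so
    annihilation persists on both sides.\<close>
  have R'z: "(\<Sum>b<m. R' a b * z b) = (\<Sum>b<m. R a b * z b) - of_real (sqrt l) * w a * (\<Sum>b<m. z b * cnj (x b))"
    for a z by (simp add: R' algebra_simps sum_subtractf sum_distrib_left)
  have R'y: "(\<Sum>a<n. cnj (R' a b) * z a) =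
      (\<Sum>a<n. cnj (R a b) * z a) - of_real (sqrt l) * x b * (\<Sum>a<n. z a * cnj (w a))"
    for b z by (simp add: R' algebra_simps sum_subtractf sum_distrib_left)
  have "partial_svd n m A (Suc k) (s(k := sqrt l)) (u(k := w)) (v(k := x))"
    unfolding partial_svd_def R'_def[symmetric]
  proof (intro conjI allI impI)
    show "0 < (s(k := sqrt l)) i" if "i < Suc k" for i using that s l by (auto simp: less_Suc_eq)
    show "orthonormal_family n (Suc k) (u(k := w))" by (intro orthonormal_family_extend u w wu)
    show "orthonormal_family m (Suc k) (v(k := x))" by (intro orthonormal_family_extend v x xv)
    show "(\<Sum>b<m. R' a b * (v(k := x)) i b) = 0" if "i < Suc k" "a < n" for i a
      using that by (auto simp: less_Suc_eq R'z Rv vx Rx xx)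
    show "(\<Sum>a<n. cnj (R' a b) * (u(k := w)) i a) = 0" if "i < Suc k" "b < m" for i b
      using that by (auto simp: less_Suc_eq R'y Ru uw Rw ww)
  qed
  then show ?thesis by blast
qed

lemma full_svd_exists:
  fixes A :: "nat \<Rightarrow> nat \<Rightarrow> complex"
  obtains k s u v where "\<And>i. i < k \<Longrightarrow> 0 < s i" "orthonormal_family n k u" "orthonormal_family m k v"
    "\<And>a b. a < n \<Longrightarrow> b < m \<Longrightarrow> A a b = (\<Sum>i<k. of_real (s i) * u i a * cnj (v i b))"
proof -
  define Q where "Q k \<longleftrightarrow> (\<exists>s u v. partial_svd n m A k s u v)" for k
  have "Q 0" by (simp add: Q_def partial_svd_def orthonormal_family_def)
  have bound: "k \<le> m" if "Q k" for k
    using that orthonormal_family_card_le by (auto simp: Q_def partial_svd_def)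
  then have Q: "Q (Greatest Q)" using GreatestI_nat[of Q 0 m] \<open>Q 0\<close> by blast
  have nQ: "\<not> Q (Suc (Greatest Q))"
    using Greatest_le_nat[of Q "Suc (Greatest Q)" m] bound by auto
  define k where "k = Greatest Q"
  obtain s u v where p: "partial_svd n m A k s u v" using Q by (auto simp: Q_def k_def)
  have "svd_residual A k s u v a b = 0" if "a < n" "b < m" for a b
    using partial_svd_extend[OF p that] nQ by (auto simp: Q_def k_def)
  then show ?thesis using p that[of k s u v] by (auto simp: partial_svd_def svd_residual_def)
qed

section \<open>Singular spaces and coherence\<close>

text \<open>Linear independence refers to the set of columns and would hide a repeated column.
  Distinctness is therefore shown separately: two equal columns put a difference of unit vectors
  into the kernel.\<close>

lemma (in vec_space) rank_of_injective:
  assumes X: "X \<in> carrier_mat n k"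
    and inj: "\<And>c. c \<in> carrier_vec k \<Longrightarrow> X *\<^sub>v c = 0\<^sub>v n \<Longrightarrow> c = 0\<^sub>v k"
  shows "rank X = k"
proof (rule lin_indpt_full_rank[OF X])
  show d: "distinct (cols X)"
    unfolding distinct_conv_nth
  proof (intro allI impI notI)
    fix i j assume ij: "i < length (cols X)" "j < length (cols X)" "i \<noteq> j" "cols X ! i = cols X ! j"
    then have ij': "i < k" "j < k" "col X i = col X j" using X by auto
    define c :: "'a vec" where "c = unit_vec k i - unit_vec k j"
    have "X *\<^sub>v c = col X i - col X j"
      using X ij'(1,2) by (auto simp: c_def mult_minus_distrib_mat_vec intro!: eq_vecI)
    also have "\<dots> = 0\<^sub>v n" using X ij' by simp
    finally have "c = 0\<^sub>v k" by (intro inj) (simp add: c_def)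
    then have "c $ i = 0" using ij' by simp
    then show False using ij' ij by (simp add: c_def)
  qed
  show "lin_indpt (set (cols X))"
    using lin_depE[OF X _ d] inj by metis
qed

text \<open>Spans and singular spaces are all brought into this form because membership then hands
  over a coordinate vector.\<close>

definition mat_range :: "complex mat \<Rightarrow> complex vec set" where
  "mat_range A = {A *\<^sub>v x | x. x \<in> carrier_vec (dim_col A)}"

lemma cspan_cols:
  assumes "A \<in> carrier_mat n k"
  shows "cspan n (set (cols A)) = mat_range A"
proof -
  interpret vec_space "TYPE(complex)" n .
  have "cspan n (set (cols A)) = col_space A" by (simp add: cspan_def col_space_def)
  also have "\<dots> = mat_range A" using assms by (auto simp: col_space_eq[OF assms] mat_range_def)
  finally show ?thesis .
qed

text \<open>The rank depends on the range alone, so it can be transferred between different matrices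
  with equal range.\<close>

lemma rank_eq_cdim:
  assumes "A \<in> carrier_mat n k"
  shows "vec_space.rank n A = cdim n (mat_range A)"
proof -
  interpret vec_space "TYPE(complex)" n .
  show ?thesis
    unfolding cspan_cols[OF assms, symmetric] rank_def cdim_def cspan_def by simp
qed

definition family_mat :: "nat \<Rightarrow> nat \<Rightarrow> (nat \<Rightarrow> complex vec) \<Rightarrow> complex mat" where
  "family_mat n r u = mat n r (\<lambda>(a, i). u i $ a)"

lemma family_mat_carrier [simp]: "family_mat n r u \<in> carrier_mat n r"
  by (simp add: family_mat_def)

lemma family_mat_mult:
  assumes "c \<in> carrier_vec r" "a < n"
  shows "(family_mat n r u *\<^sub>v c) $ a = (\<Sum>i<r. c $ i * u i $ a)"
  using assms by (simp add: family_mat_def scalar_prod_def atLeast0LessThan mult.commute)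

lemma cspan_family:
  assumes "\<And>i. i < r \<Longrightarrow> u i \<in> carrier_vec n"
  shows "cspan n (u ` {..<r}) = mat_range (family_mat n r u)"
proof -
  have "col (family_mat n r u) i = u i" if "i < r" for i
    using assms[OF that] that by (intro eq_vecI) (auto simp: family_mat_def)
  then have "set (cols (family_mat n r u)) = u ` {..<r}"
    by (auto simp: cols_def family_mat_def atLeast0LessThan)
  then show ?thesis using cspan_cols[OF family_mat_carrier] by metis
qed

lemma scalar_prod_conjugate:
  fixes x y :: "complex vec"
  assumes "y \<in> carrier_vec n"
  shows "x \<bullet>c y = (\<Sum>a<n. x $ a * cnj (y $ a))"
  using assms by (simp add: scalar_prod_def atLeast0LessThan)

lemma orthonormal_family_vec_iff:
  assumes "\<And>i. i < r \<Longrightarrow> u i \<in> carrier_vec n"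
  shows "orthonormal_family n r (\<lambda>i a. u i $ a) \<longleftrightarrow>
    (\<forall>i<r. \<forall>j<r. u i \<bullet>c u j = (if i = j then 1 else 0))"
  using assms by (simp add: orthonormal_family_def scalar_prod_conjugate[of _ n])

lemma orthonormal_family_coeff:
  assumes "orthonormal_family n r u" "j < r"
  shows "(\<Sum>a<n. (\<Sum>i<r. c i * u i a) * cnj (u j a)) = c j"
proof -
  have "(\<Sum>a<n. (\<Sum>i<r. c i * u i a) * cnj (u j a)) = (\<Sum>i<r. c i * (\<Sum>a<n. u i a * cnj (u j a)))"
    by (simp add: sum_distrib_left sum_distrib_right mult.assoc) (rule sum.swap)
  also have "\<dots> = (\<Sum>i<r. if i = j then c i else 0)"
    using assms by (intro sum.cong) (auto simp: orthonormal_family_def)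
  also have "\<dots> = c j" using assms(2) by simp
  finally show ?thesis .
qed

lemma rank_family_mat:
  assumes "orthonormal_family n r (\<lambda>i a. u i $ a)"
  shows "vec_space.rank n (family_mat n r u) = r"
proof (rule vec_space.rank_of_injective[OF family_mat_carrier])
  fix c :: "complex vec" assume c: "c \<in> carrier_vec r" "family_mat n r u *\<^sub>v c = 0\<^sub>v n"
  have "c $ j = 0" if "j < r" for j
  proof -
    have "(\<Sum>i<r. c $ i * u i $ a) = 0" if "a < n" for a
      using family_mat_mult[OF c(1) that, of u] c(2) that by simp
    then show ?thesis using orthonormal_family_coeff[OF assms that, of "\<lambda>i. c $ i"] by simp
  qed
  then show "c = 0\<^sub>v r" using c(1) by (intro eq_vecI) auto
qed

text \<open>Omits the condition on the rank from the compact decomposition; it is implied by the rest.\<close>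

definition svd_form ::
  "complex mat \<Rightarrow> nat \<Rightarrow> (nat \<Rightarrow> real) \<Rightarrow> (nat \<Rightarrow> complex vec) \<Rightarrow> (nat \<Rightarrow> complex vec) \<Rightarrow> bool" where
  "svd_form A r s u v \<longleftrightarrow>
     (\<forall>i<r. 0 < s i) \<and>
     (\<forall>i<r. u i \<in> carrier_vec (dim_row A) \<and> v i \<in> carrier_vec (dim_col A)) \<and>
     orthonormal_family (dim_row A) r (\<lambda>i a. u i $ a) \<and>
     orthonormal_family (dim_col A) r (\<lambda>i b. v i $ b) \<and>
     (\<forall>a<dim_row A. \<forall>b<dim_col A.
        A $$ (a, b) = (\<Sum>i<r. of_real (s i) * (u i $ a) * cnj (v i $ b)))"

lemma compact_svd_iff_form:
  "compact_svd A r s u v \<longleftrightarrow> r = vec_space.rank (dim_row A) A \<and> svd_form A r s u v"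
proof -
  have eq: "A = mat (dim_row A) (dim_col A) (\<lambda>(a, b). f a b) \<longleftrightarrow>
      (\<forall>a<dim_row A. \<forall>b<dim_col A. A $$ (a, b) = f a b)" for f
    by (auto simp: mat_eq_iff)
  show ?thesis
    unfolding compact_svd_def svd_form_def eq
    using orthonormal_family_vec_iff[of r u "dim_row A"] orthonormal_family_vec_iff[of r v "dim_col A"]
    by blast
qed

text \<open>The coefficients of \<open>A x\<close> along the \<open>u i\<close> are the inner
  products of \<open>x\<close> with the \<open>v i\<close>, scaled by \<open>s i\<close>. The right
  side involves the decomposition and the left does not; this is what makes the singular space
  independent of the choice.\<close>

lemma svd_form_range:
  assumes "svd_form A r s u v"
  shows "mat_range A = mat_range (family_mat (dim_row A) r u)"
proof -
  define n m where "n = dim_row A" and "m = dim_col A"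
  have A: "A \<in> carrier_mat n m" by (simp add: n_def m_def)
  have s: "\<And>i. i < r \<Longrightarrow> s i \<noteq> 0" and v: "orthonormal_family m r (\<lambda>i b. v i $ b)"
    and ix: "\<And>a b. a < n \<Longrightarrow> b < m \<Longrightarrow> A $$ (a, b) = (\<Sum>i<r. of_real (s i) * (u i $ a) * cnj (v i $ b))"
    using assms by (force simp: svd_form_def n_def m_def)+
  have Ax: "(A *\<^sub>v x) $ a = (\<Sum>i<r. of_real (s i) * (\<Sum>b<m. x $ b * cnj (v i $ b)) * u i $ a)"
    if "a < n" "x \<in> carrier_vec m" for a x
  proof -
    have "(A *\<^sub>v x) $ a = (\<Sum>b<m. A $$ (a, b) * x $ b)"
      using A that by (simp add: scalar_prod_def atLeast0LessThan)
    also have "\<dots> = (\<Sum>b<m. (\<Sum>i<r. of_real (s i) * (u i $ a) * cnj (v i $ b)) * x $ b)"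
      using ix that(1) by simp
    also have "\<dots> = (\<Sum>i<r. of_real (s i) * (\<Sum>b<m. x $ b * cnj (v i $ b)) * u i $ a)"
      by (simp add: sum_distrib_left sum_distrib_right mult_ac) (rule sum.swap)
    finally show ?thesis .
  qed
  have "mat_range A = mat_range (family_mat n r u)"
  proof (intro equalityI subsetI)
    fix y assume "y \<in> mat_range A"
    then obtain x where x: "x \<in> carrier_vec m" "y = A *\<^sub>v x" by (auto simp: mat_range_def m_def)
    define c where "c = vec r (\<lambda>i. of_real (s i) * (\<Sum>b<m. x $ b * cnj (v i $ b)))"
    have c: "c \<in> carrier_vec r" by (simp add: c_def)
    have "y = family_mat n r u *\<^sub>v c"
    proof (rule eq_vecI)
      show "dim_vec y = dim_vec (family_mat n r u *\<^sub>v c)" using A x by (simp add: family_mat_def)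
      fix a assume "a < dim_vec (family_mat n r u *\<^sub>v c)"
      then have a: "a < n" by (simp add: family_mat_def)
      have "y $ a = (\<Sum>i<r. c $ i * u i $ a)" unfolding x(2) Ax[OF a x(1)] by (simp add: c_def)
      then show "y $ a = (family_mat n r u *\<^sub>v c) $ a" using family_mat_mult[OF c a] by simp
    qed
    then show "y \<in> mat_range (family_mat n r u)"
      using c by (auto simp: mat_range_def family_mat_def)
  next
    fix y assume "y \<in> mat_range (family_mat n r u)"
    then obtain c where c: "c \<in> carrier_vec r" "y = family_mat n r u *\<^sub>v c"
      by (auto simp: mat_range_def family_mat_def)
    \<comment> \<open>Dividing by the positive \<open>s i\<close> undoes the scaling, so
      orthonormality of \<open>v\<close> returns the prescribed coefficients.\<close>
    define x where "x = vec m (\<lambda>b. \<Sum>i<r. c $ i / of_real (s i) * v i $ b)"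
    have x: "x \<in> carrier_vec m" by (simp add: x_def)
    have co: "(\<Sum>b<m. x $ b * cnj (v i $ b)) = c $ i / of_real (s i)" if "i < r" for i
      using orthonormal_family_coeff[OF v that, of "\<lambda>i. c $ i / of_real (s i)"] by (simp add: x_def)
    have "y = A *\<^sub>v x"
    proof (rule eq_vecI)
      show "dim_vec y = dim_vec (A *\<^sub>v x)" using A c by (simp add: family_mat_def)
      fix a assume "a < dim_vec (A *\<^sub>v x)"
      then have a: "a < n" using A by simp
      have "(A *\<^sub>v x) $ a = (\<Sum>i<r. c $ i * u i $ a)"
        unfolding Ax[OF a x] by (intro sum.cong) (auto simp: co s)
      then show "y $ a = (A *\<^sub>v x) $ a" using c family_mat_mult[OF c(1) a] by simp
    qed
    then show "y \<in> mat_range A" using x by (auto simp: mat_range_def m_def)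
  qed
  then show ?thesis by (simp add: n_def)
qed

lemma svd_form_rank:
  assumes "svd_form A r s u v"
  shows "vec_space.rank (dim_row A) A = r"
proof -
  have "vec_space.rank (dim_row A) A = cdim (dim_row A) (mat_range A)"
    by (rule rank_eq_cdim[of _ _ "dim_col A"]) simp
  also have "\<dots> = vec_space.rank (dim_row A) (family_mat (dim_row A) r u)"
    unfolding svd_form_range[OF assms] by (rule rank_eq_cdim[symmetric, OF family_mat_carrier])
  also have "\<dots> = r" using assms by (intro rank_family_mat) (simp add: svd_form_def)
  finally show ?thesis .
qed

lemma compact_svd_iff: "compact_svd A r s u v \<longleftrightarrow> svd_form A r s u v"
  using svd_form_rank[of A r s u v] by (auto simp: compact_svd_iff_form)

lemma compact_svd_exists: "\<exists>r s u v. compact_svd A r s u v"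
proof (rule full_svd_exists[of "dim_row A" "dim_col A" "\<lambda>a b. A $$ (a, b)"])
  fix k s u v
  assume sv: "\<And>i. i < k \<Longrightarrow> (0::real) < s i"
      "orthonormal_family (dim_row A) k u" "orthonormal_family (dim_col A) k v"
      "\<And>a b. a < dim_row A \<Longrightarrow> b < dim_col A \<Longrightarrow>
        A $$ (a, b) = (\<Sum>i<k. of_real (s i) * u i a * cnj (v i b))"
  have "svd_form A k s (\<lambda>i. vec (dim_row A) (u i)) (\<lambda>i. vec (dim_col A) (v i))"
    using sv by (simp add: svd_form_def orthonormal_family_def)
  then show "\<exists>r s u v. compact_svd A r s u v" unfolding compact_svd_iff by blast
qed

definition ctranspose :: "complex mat \<Rightarrow> complex mat" where
  "ctranspose A = mat (dim_col A) (dim_row A) (\<lambda>(b, a). cnj (A $$ (a, b)))"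

text \<open>Without the rank condition the notion is symmetric in the two families. Statements about
  right singular vectors thus become statements about left ones of the conjugate transpose.\<close>

lemma compact_svd_ctranspose:
  assumes "compact_svd A r s u v"
  shows "compact_svd (ctranspose A) r s v u"
  using assms by (auto simp: compact_svd_iff svd_form_def ctranspose_def mult_ac)

lemma compact_svd_span:
  assumes "compact_svd A r s u v"
  shows "cspan (dim_row A) (u ` {..<r}) = mat_range A"
  using assms svd_form_range[of A r s u v] cspan_family[of r u "dim_row A"]
  by (simp add: compact_svd_iff svd_form_def)

lemma left_space_eq: "left_space A = mat_range A"
  unfolding left_space_def
proof (rule the_equality)
  obtain r s u v where "compact_svd A r s u v" using compact_svd_exists by blast
  with compact_svd_span[OF this]
  show "\<exists>r s u v. compact_svd A r s u v \<and> mat_range A = cspan (dim_row A) (u ` {..<r})" by blast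
qed (use compact_svd_span in blast)

lemma right_space_eq: "right_space A = mat_range (ctranspose A)"
  unfolding right_space_def
proof (rule the_equality)
  have span: "cspan (dim_col A) (v ` {..<r}) = mat_range (ctranspose A)"
    if "compact_svd A r s u v" for r s u v
    using compact_svd_span[OF compact_svd_ctranspose[OF that]] by (simp add: ctranspose_def)
  obtain r s u v where "compact_svd A r s u v" using compact_svd_exists by blast
  with span[OF this]
  show "\<exists>r s u v. compact_svd A r s u v \<and>
      mat_range (ctranspose A) = cspan (dim_col A) (v ` {..<r})" by blast
  show "V = mat_range (ctranspose A)"
    if "\<exists>r s u v. compact_svd A r s u v \<and> V = cspan (dim_col A) (v ` {..<r})" for V
    using that span by blast
qed

section \<open>Orthogonal projections and coherence in terms of singular vectors\<close>

lemma norm2_square: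
  assumes "x \<in> carrier_vec n"
  shows "(norm2 x)\<^sup>2 = (\<Sum>a<n. (cmod (x $ a))\<^sup>2)"
  using assms by (simp add: norm2_def sum_nonneg)

lemma oproj_unit_vec:
  assumes u: "orthonormal_family n r (\<lambda>i a. u i $ a)" and a: "a < n"
  defines "p \<equiv> family_mat n r u *\<^sub>v vec r (\<lambda>i. cnj (u i $ a))"
  shows "oproj (mat_range (family_mat n r u)) (unit_vec n a) = p"
    "(norm2 p)\<^sup>2 = (\<Sum>i<r. (cmod (u i $ a))\<^sup>2)"
proof -
  define U where "U = mat_range (family_mat n r u)"
  have UI: "family_mat n r u *\<^sub>v c \<in> U" if "c \<in> carrier_vec r" for c
    using that by (auto simp: U_def mat_range_def family_mat_def)
  have UE: "\<exists>c\<in>carrier_vec r. w = family_mat n r u *\<^sub>v c" if "w \<in> U" for w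
    using that by (auto simp: U_def mat_range_def family_mat_def)
  have car: "w \<in> carrier_vec n" if "w \<in> U" for w
    using UE[OF that] mult_mat_vec_carrier[OF family_mat_carrier] by blast
  have pU: "p \<in> U" unfolding p_def by (rule UI) simp
  have pa: "p $ b = (\<Sum>i<r. cnj (u i $ a) * u i $ b)" if "b < n" for b
    using that by (simp add: p_def family_mat_mult)
  have "(norm2 p)\<^sup>2 = (\<Sum>b<n. (cmod (\<Sum>i<r. cnj (u i $ a) * u i $ b))\<^sup>2)"
    using norm2_square[OF car[OF pU]] by (simp add: pa)
  also have "\<dots> = (\<Sum>i<r. (cmod (u i $ a))\<^sup>2)" by (simp add: orthonormal_family_norm[OF u])
  finally show "(norm2 p)\<^sup>2 = (\<Sum>i<r. (cmod (u i $ a))\<^sup>2)" .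
  have orth: "(unit_vec n a - p) \<bullet>c w = 0" if w: "w \<in> U" for w
  proof -
    obtain c where c: "c \<in> carrier_vec r" "w = family_mat n r u *\<^sub>v c" using UE[OF w] by blast
    have w': "w $ b = (\<Sum>i<r. c $ i * u i $ b)" if "b < n" for b
      using that c by (simp add: family_mat_mult)
    have "p \<bullet>c w = (\<Sum>b<n. p $ b * cnj (w $ b))" by (rule scalar_prod_conjugate[OF car[OF w]])
    also have "\<dots> = (\<Sum>b<n. p $ b * (\<Sum>j<r. cnj (c $ j) * cnj (u j $ b)))"
      by (simp add: w')
    also have "\<dots> = (\<Sum>b<n. \<Sum>j<r. cnj (c $ j) * (p $ b * cnj (u j $ b)))"
      by (simp add: sum_distrib_left mult_ac)
    also have "\<dots> = (\<Sum>j<r. cnj (c $ j) * (\<Sum>b<n. p $ b * cnj (u j $ b)))"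
      unfolding sum_distrib_left by (rule sum.swap)
    also have "\<dots> = (\<Sum>j<r. cnj (c $ j) * cnj (u j $ a))"
      using orthonormal_family_coeff[OF u, of _ "\<lambda>i. cnj (u i $ a)"]
      by (intro sum.cong refl) (simp add: pa)
    also have "\<dots> = cnj (w $ a)" using a by (simp add: w')
    also have "\<dots> = unit_vec n a \<bullet>c w"
      using a car[OF w] by simp
    finally show ?thesis
      using car[OF pU] car[OF w] by (simp add: minus_scalar_prod_distrib[of _ n])
  qed
  \<comment> \<open>The description by \<open>THE\<close> also requires uniqueness:
    \<open>p - q\<close> lies in \<open>U\<close> and is orthogonal to \<open>U\<close>, hence to
    itself.\<close>
  have uniq: "q = p" if q: "q \<in> U" "\<forall>w\<in>U. (unit_vec n a - q) \<bullet>c w = 0" for q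
  proof -
    obtain c where c: "c \<in> carrier_vec r" "q = family_mat n r u *\<^sub>v c" using UE[OF q(1)] by blast
    have "p - q = family_mat n r u *\<^sub>v (vec r (\<lambda>i. cnj (u i $ a)) - c)"
      using c by (simp add: p_def mult_minus_distrib_mat_vec[OF family_mat_carrier])
    then have w: "p - q \<in> U" using UI c(1) by simp
    note cs = car[OF pU] car[OF q(1)] car[OF w]
    have "(p - q) \<bullet>c (p - q) = (unit_vec n a - q) \<bullet>c (p - q) - (unit_vec n a - p) \<bullet>c (p - q)"
      using cs by (simp add: minus_scalar_prod_distrib[of _ n])
    also have "\<dots> = 0" using q(2) w orth by simp
    finally have "p - q = 0\<^sub>v n" using conjugate_square_eq_0_vec[OF cs(3)] by simp
    then have "p $ b - q $ b = 0" if "b < n" for b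
      using that cs by (metis carrier_vecD index_minus_vec(1) index_zero_vec(1))
    then show ?thesis using cs by (intro eq_vecI) auto
  qed
  show "oproj (mat_range (family_mat n r u)) (unit_vec n a) = p"
    unfolding oproj_def U_def[symmetric]
  proof (rule the_equality)
    show "p \<in> U \<and> (\<forall>w\<in>U. (unit_vec n a - p) \<bullet>c w = 0)" using pU orth by blast
  qed (use uniq in blast)
qed

lemma coherence_eq:
  assumes "compact_svd A r s u v"
  shows "coherence (dim_row A) (mat_range A) =
    real (dim_row A) / real r * (SUP a\<in>{..<dim_row A}. \<Sum>i<r. (cmod (u i $ a))\<^sup>2)"
proof -
  have f: "svd_form A r s u v" using assms by (simp add: compact_svd_iff)
  then have u: "orthonormal_family (dim_row A) r (\<lambda>i a. u i $ a)" by (simp add: svd_form_def)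
  have "cdim (dim_row A) (mat_range A) = r"
    using rank_eq_cdim[of A "dim_row A" "dim_col A"] svd_form_rank[OF f] by simp
  moreover have "(norm2 (oproj (mat_range A) (unit_vec (dim_row A) a)))\<^sup>2 = (\<Sum>i<r. (cmod (u i $ a))\<^sup>2)"
    if "a < dim_row A" for a
    using oproj_unit_vec[OF u that] by (simp add: svd_form_range[OF f])
  ultimately show ?thesis by (simp add: coherence_def)
qed

text \<open>The row energies add up to \<open>r\<close>, so their maximum is at least the average
  \<open>r / n\<close>; this gives the lower bound \<open>1\<close>.\<close>

lemma coherence_bounds:
  assumes "compact_svd A r s u v" "0 < dim_row A" "0 < r"
  shows "1 \<le> coherence (dim_row A) (mat_range A)"
    and "(\<And>a. a < dim_row A \<Longrightarrow> (\<Sum>i<r. (cmod (u i $ a))\<^sup>2) \<le> B) \<Longrightarrow>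
      coherence (dim_row A) (mat_range A) \<le> real (dim_row A) / real r * B"
proof -
  define n where "n = dim_row A"
  define f where "f a = (\<Sum>i<r. (cmod (u i $ a))\<^sup>2)" for a
  have eq: "coherence n (mat_range A) = real n / real r * (SUP a\<in>{..<n}. f a)"
    using coherence_eq[OF assms(1)] by (simp add: n_def f_def)
  have n: "0 < n" using assms by (simp add: n_def)
  have "f a \<le> (SUP a\<in>{..<n}. f a)" if "a < n" for a
    using that by (intro cSUP_upper) auto
  then have "(\<Sum>a<n. f a) \<le> (\<Sum>a<n. (SUP a\<in>{..<n}. f a))" by (intro sum_mono) auto
  moreover have "(\<Sum>a<n. f a) = real r"
    using assms(1) orthonormal_family_total[of n r "\<lambda>i a. u i $ a"]
    by (simp add: compact_svd_iff svd_form_def n_def f_def)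
  ultimately have "real r \<le> real n * (SUP a\<in>{..<n}. f a)" by simp
  then show "1 \<le> coherence (dim_row A) (mat_range A)"
    unfolding n_def[symmetric] eq using assms(3) by (simp add: field_simps)
  assume "\<And>a. a < dim_row A \<Longrightarrow> (\<Sum>i<r. (cmod (u i $ a))\<^sup>2) \<le> B"
  then have "(SUP a\<in>{..<n}. f a) \<le> B" using n by (intro cSUP_least) (auto simp: n_def f_def lessThan_empty_iff)
  then show "coherence (dim_row A) (mat_range A) \<le> real (dim_row A) / real r * B"
    unfolding n_def[symmetric] eq by (intro mult_left_mono) auto
qed

section \<open>Products of nearly orthogonal matrices\<close>

text \<open>These are the properties of a steering matrix that the linear algebra uses. They survive
  entrywise conjugation, as the right singular space requires.\<close>

definition nearly_orthogonal :: "nat \<Rightarrow> nat \<Rightarrow> real \<Rightarrow> complex mat \<Rightarrow> bool" where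
  "nearly_orthogonal n K b X \<longleftrightarrow> X \<in> carrier_mat n K \<and>
     (\<forall>a<n. \<forall>k<K. cmod (X $$ (a, k)) = 1) \<and>
     (\<forall>k<K. \<forall>l<K. k \<noteq> l \<longrightarrow> cmod (\<Sum>a<n. X $$ (a, k) * cnj (X $$ (a, l))) \<le> b)"

lemma mult_mat_vec_sum:
  fixes X :: "complex mat"
  assumes "X \<in> carrier_mat n k" "c \<in> carrier_vec k" "a < n"
  shows "(X *\<^sub>v c) $ a = (\<Sum>i<k. c $ i * X $$ (a, i))"
  using assms by (simp add: scalar_prod_def atLeast0LessThan mult.commute)

text \<open>A quadratic-form version of diagonal dominance: each off-diagonal product is split by
  the inequality of arithmetic and geometric means.\<close>

lemma gram_lower_bound:
  assumes X: "nearly_orthogonal n K b X" and b: "0 \<le> b"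
  shows "(real n - (real K - 1) * b) * (\<Sum>k<K. (cmod (c k))\<^sup>2)
    \<le> (\<Sum>a<n. (cmod (\<Sum>k<K. c k * X $$ (a, k)))\<^sup>2)"
proof -
  define G where "G k l = (\<Sum>a<n. X $$ (a, k) * cnj (X $$ (a, l)))" for k l
  define S where "S = (\<Sum>k<K. (cmod (c k))\<^sup>2)"
  have Gd: "G k k = of_real (real n)" if "k < K" for k
  proof -
    have "G k k = of_real (\<Sum>a<n. (cmod (X $$ (a, k)))\<^sup>2)"
      unfolding G_def by (rule sum_mult_cnj_self)
    then show ?thesis using X that by (simp add: nearly_orthogonal_def)
  qed
  \<comment> \<open>The subtracted term is kept on the diagonal too, where it equals
    \<open>b\<close> times the squared modulus; the extra \<open>b\<close> beside
    \<open>real n\<close> restores it. Summation over all pairs then gives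
    \<open>n + b - K b = n - (K - 1) b\<close>.\<close>
  have term_ge: "(if k = l then (real n + b) * (cmod (c k))\<^sup>2 else 0) - b / 2 * ((cmod (c k))\<^sup>2 + (cmod (c l))\<^sup>2)
      \<le> Re (c k * cnj (c l) * G k l)" if "k < K" "l < K" for k l
  proof (cases "k = l")
    case True
    have "c k * cnj (c k) = of_real ((cmod (c k))\<^sup>2)" by (rule complex_norm_square[symmetric])
    then have "c k * cnj (c l) * G k l = of_real ((cmod (c k))\<^sup>2 * real n)"
      using True Gd[OF that(1)] by simp
    then have "Re (c k * cnj (c l) * G k l) = (cmod (c k))\<^sup>2 * real n" by (simp only: Re_complex_of_real)
    then show ?thesis using True by (simp add: algebra_simps)
  next
    case False
    have "cmod (c k * cnj (c l) * G k l) = (cmod (c k) * cmod (c l)) * cmod (G k l)"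
      by (simp add: norm_mult)
    also have "\<dots> \<le> (cmod (c k) * cmod (c l)) * b"
      using X that False by (intro mult_left_mono) (auto simp: nearly_orthogonal_def G_def)
    also have "\<dots> = b / 2 * (2 * cmod (c k) * cmod (c l))" by simp
    also have "\<dots> \<le> b / 2 * ((cmod (c k))\<^sup>2 + (cmod (c l))\<^sup>2)"
      using b by (intro mult_left_mono sum_squares_bound) auto
    finally show ?thesis
      using False abs_Re_le_cmod[of "c k * cnj (c l) * G k l"] by simp
  qed
  have "of_real (\<Sum>a<n. (cmod (\<Sum>k<K. c k * X $$ (a, k)))\<^sup>2) = (\<Sum>k<K. \<Sum>l<K. c k * cnj (c l) * G k l)"
    unfolding G_def by (rule norm_combination)
  then have "(\<Sum>a<n. (cmod (\<Sum>k<K. c k * X $$ (a, k)))\<^sup>2) = Re (\<Sum>k<K. \<Sum>l<K. c k * cnj (c l) * G k l)"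
    by (metis Re_complex_of_real)
  also have "\<dots> = (\<Sum>k<K. \<Sum>l<K. Re (c k * cnj (c l) * G k l))" by simp
  also have "\<dots> \<ge> (\<Sum>k<K. \<Sum>l<K. (if k = l then (real n + b) * (cmod (c k))\<^sup>2 else 0)
      - b / 2 * ((cmod (c k))\<^sup>2 + (cmod (c l))\<^sup>2))"
    using term_ge by (intro sum_mono) auto
  also have "(\<Sum>k<K. \<Sum>l<K. (if k = l then (real n + b) * (cmod (c k))\<^sup>2 else 0)
      - b / 2 * ((cmod (c k))\<^sup>2 + (cmod (c l))\<^sup>2)) = (real n + b) * S - b / 2 * (real K * S + real K * S)"
  proof -
    have "(\<Sum>k<K. \<Sum>l<K. if k = l then (real n + b) * (cmod (c k))\<^sup>2 else 0) = (real n + b) * S"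
      by (simp add: S_def sum_distrib_left)
    moreover have "(\<Sum>k<K. \<Sum>l<K. (cmod (c k))\<^sup>2 + (cmod (c l))\<^sup>2) = real K * S + real K * S"
      by (simp add: sum.distrib S_def flip: sum_distrib_left)
    ultimately show ?thesis by (simp only: sum_subtractf flip: sum_distrib_left)
  qed
  also have "\<dots> = (real n - (real K - 1) * b) * S" by (simp add: algebra_simps)
  finally show ?thesis by (simp only: S_def)
qed

lemma nearly_orthogonal_injective:
  assumes X: "nearly_orthogonal n K b X" and b: "0 \<le> b" "0 < real n - (real K - 1) * b"
    and c: "c \<in> carrier_vec K" "X *\<^sub>v c = 0\<^sub>v n"
  shows "c = 0\<^sub>v K"
proof -
  have car: "X \<in> carrier_mat n K" using X by (simp add: nearly_orthogonal_def)
  have "(\<Sum>k<K. c $ k * X $$ (a, k)) = 0" if "a < n" for a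
    using mult_mat_vec_sum[OF car c(1) that] that by (simp add: c(2))
  then have "(real n - (real K - 1) * b) * (\<Sum>k<K. (cmod (c $ k))\<^sup>2) \<le> 0"
    using gram_lower_bound[OF X b(1), of "\<lambda>k. c $ k"] by simp
  then have "(\<Sum>k<K. (cmod (c $ k))\<^sup>2) \<le> 0" using b(2) by (simp add: mult_le_0_iff)
  then have "(\<Sum>k<K. (cmod (c $ k))\<^sup>2) = 0" by (intro antisym sum_nonneg) auto
  then have "\<forall>k<K. c $ k = 0" by (simp add: sum_nonneg_eq_0_iff)
  then show ?thesis using c(1) by (intro eq_vecI) auto
qed

lemma nearly_orthogonal_cnj:
  assumes "nearly_orthogonal n K b X"
  shows "nearly_orthogonal n K b (map_mat cnj X)"
proof -
  have "cmod (\<Sum>a<n. cnj (X $$ (a, k)) * X $$ (a, l)) = cmod (\<Sum>a<n. X $$ (a, k) * cnj (X $$ (a, l)))" for k l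
  proof -
    have "(\<Sum>a<n. cnj (X $$ (a, k)) * X $$ (a, l)) = cnj (\<Sum>a<n. X $$ (a, k) * cnj (X $$ (a, l)))" by simp
    then show ?thesis by (simp only: complex_mod_cnj)
  qed
  then show ?thesis using assms by (auto simp: nearly_orthogonal_def)
qed

lemma mat_range_mult_subset:
  assumes "A \<in> carrier_mat n k" "B \<in> carrier_mat k m"
  shows "mat_range (A * B) \<subseteq> mat_range A"
  using assms by (force simp: mat_range_def)

text \<open>If \<open>p\<close> is the projection of the \<open>a\<close>-th unit vector, then its squared norm \<open>t\<close> is also its
  \<open>a\<close>-th entry. Writing \<open>p = X c\<close>, the entry is at most \<open>sqrt K\<close> times the norm of \<open>c\<close>, while
  the norm of \<open>p\<close> dominates that of \<open>c\<close>; so \<open>t\<^sup>2\<close> is bounded by a multiple of \<open>t\<close>.\<close>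

lemma row_energy_bound:
  assumes svd: "compact_svd A r s u v" and sub: "mat_range A \<subseteq> mat_range X"
    and X: "nearly_orthogonal (dim_row A) K b X" and b: "0 \<le> b"
    and pos: "0 < real (dim_row A) - (real K - 1) * b" and a: "a < dim_row A"
  shows "(\<Sum>i<r. (cmod (u i $ a))\<^sup>2) \<le> real K / (real (dim_row A) - (real K - 1) * b)"
proof -
  define n where "n = dim_row A"
  define \<delta> where "\<delta> = real n - (real K - 1) * b"
  define t where "t = (\<Sum>i<r. (cmod (u i $ a))\<^sup>2)"
  have X: "nearly_orthogonal n K b X" and a: "a < n" and pos: "0 < \<delta>"
    using X a pos by (simp_all add: n_def \<delta>_def)
  have car: "X \<in> carrier_mat n K" using X by (simp add: nearly_orthogonal_def)
  have f: "svd_form A r s u v" using svd by (simp add: compact_svd_iff)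
  then have u: "orthonormal_family n r (\<lambda>i a. u i $ a)" by (simp add: svd_form_def n_def)
  define d where "d = vec r (\<lambda>i. cnj (u i $ a))"
  define p where "p = family_mat n r u *\<^sub>v d"
  have "p \<in> mat_range A"
    unfolding svd_form_range[OF f] n_def[symmetric]
    by (auto simp: mat_range_def p_def d_def family_mat_def intro!: exI[of _ d])
  then obtain c where c: "c \<in> carrier_vec K" "p = X *\<^sub>v c" using sub car by (auto simp: mat_range_def)
  have pc: "p $ b = (\<Sum>k<K. c $ k * X $$ (b, k))" if "b < n" for b
    unfolding c(2) by (rule mult_mat_vec_sum[OF car c(1) that])
  have pu: "p $ b = (\<Sum>i<r. cnj (u i $ a) * u i $ b)" if "b < n" for b
    using that by (simp add: p_def d_def family_mat_mult)
  have "(\<Sum>b<n. (cmod (p $ b))\<^sup>2) = t"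
    using orthonormal_family_norm[OF u, of "\<lambda>i. cnj (u i $ a)"] by (simp add: pu t_def)
  then have low: "\<delta> * (\<Sum>k<K. (cmod (c $ k))\<^sup>2) \<le> t"
    using gram_lower_bound[OF X b, of "\<lambda>k. c $ k"] by (simp add: pc \<delta>_def)
  have "p $ a = (\<Sum>i<r. u i $ a * cnj (u i $ a))" by (simp add: pu[OF a] mult.commute)
  also have "\<dots> = of_real t" unfolding t_def by (rule sum_mult_cnj_self)
  finally have "cmod (\<Sum>k<K. c $ k * X $$ (a, k)) = \<bar>t\<bar>" by (simp flip: pc[OF a])
  moreover have "cmod (\<Sum>k<K. c $ k * X $$ (a, k)) \<le> (\<Sum>k<K. cmod (c $ k))"
    using X a by (intro order.trans[OF norm_sum] sum_mono) (simp add: norm_mult nearly_orthogonal_def)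
  moreover have t0: "0 \<le> t" unfolding t_def by (intro sum_nonneg) auto
  ultimately have "t \<le> (\<Sum>k<K. cmod (c $ k))" by simp
  then have "t\<^sup>2 \<le> (\<Sum>k<K. cmod (c $ k))\<^sup>2" using t0 by (intro power_mono)
  also have "\<dots> \<le> (\<Sum>k<K. (cmod (c $ k))\<^sup>2) * real K"
    using sum_squared_le_sum_of_squares[of "\<lambda>k. cmod (c $ k)" "{..<K}"] by simp
  finally have "\<delta> * t\<^sup>2 \<le> \<delta> * ((\<Sum>k<K. (cmod (c $ k))\<^sup>2) * real K)" using pos by (intro mult_left_mono) auto
  also have "\<dots> = (\<delta> * (\<Sum>k<K. (cmod (c $ k))\<^sup>2)) * real K" by simp
  also have "\<dots> \<le> t * real K" using low by (intro mult_right_mono) auto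
  finally have "t * (\<delta> * t) \<le> t * real K" by (simp add: power2_eq_square mult_ac)
  then have "\<delta> * t \<le> real K" using t0 by (cases "t = 0") (auto simp: mult_le_cancel_left)
  then show ?thesis using pos by (simp add: t_def \<delta>_def n_def pos_le_divide_eq mult.commute)
qed

text \<open>Multiplying \<open>Y = D Z^T\<close> by the conjugate of \<open>Z\<close> gives the
  square matrix \<open>T\<close>, the diagonal \<open>D\<close> times a Gram matrix. Injectivity of
  \<open>Z\<close> makes \<open>T\<close> invertible, and an inverse of \<open>T\<close> provides
  preimages under \<open>Y\<close>.\<close>

lemma diag_transpose_surj:
  assumes D: "nonzero_diag K D" and Z: "Z \<in> carrier_mat m K"
    and inj: "\<And>c. c \<in> carrier_vec K \<Longrightarrow> Z *\<^sub>v c = 0\<^sub>v m \<Longrightarrow> c = 0\<^sub>v K"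
    and y: "y \<in> carrier_vec K"
  shows "\<exists>w\<in>carrier_vec m. (D * transpose_mat Z) *\<^sub>v w = y"
proof -
  define Y where "Y = D * transpose_mat Z"
  define Z' where "Z' = map_mat cnj Z"
  have Dc: "D \<in> carrier_mat K K" and Dd: "\<And>i j. i < K \<Longrightarrow> j < K \<Longrightarrow> i \<noteq> j \<Longrightarrow> D $$ (i, j) = 0"
    and Dn: "\<And>i. i < K \<Longrightarrow> D $$ (i, i) \<noteq> 0"
    using D by (auto simp: nonzero_diag_def diagonal_mat_def)
  have Y: "Y \<in> carrier_mat K m" using Dc Z by (simp add: Y_def)
  have Z': "Z' \<in> carrier_mat m K" using Z by (simp add: Z'_def)
  define T where "T = Y * Z'"
  have T: "T \<in> carrier_mat K K" using Y Z' by (simp add: T_def)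
  have Yx: "(Y *\<^sub>v x) $ k = D $$ (k, k) * (\<Sum>a<m. x $ a * Z $$ (a, k))"
    if "k < K" "x \<in> carrier_vec m" for k x
  proof -
    have "Y *\<^sub>v x = D *\<^sub>v (transpose_mat Z *\<^sub>v x)"
      unfolding Y_def using Dc Z that by (intro assoc_mult_mat_vec) auto
    then have "(Y *\<^sub>v x) $ k = (\<Sum>l<K. (transpose_mat Z *\<^sub>v x) $ l * D $$ (k, l))"
      using Dc Z that mult_mat_vec_sum[OF Dc, of "transpose_mat Z *\<^sub>v x" k] by simp
    also have "\<dots> = (\<Sum>l<K. if l = k then (transpose_mat Z *\<^sub>v x) $ k * D $$ (k, k) else 0)"
      using that Dd by (intro sum.cong) auto
    also have "\<dots> = D $$ (k, k) * (transpose_mat Z *\<^sub>v x) $ k" using that by simp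
    also have "(transpose_mat Z *\<^sub>v x) $ k = (\<Sum>a<m. x $ a * Z $$ (a, k))"
      using mult_mat_vec_sum[of "transpose_mat Z" K m x k] Z that by simp
    finally show ?thesis .
  qed
  have "c = 0\<^sub>v K" if c: "c \<in> carrier_vec K" "T *\<^sub>v c = 0\<^sub>v K" for c
  proof -
    define x where "x = Z' *\<^sub>v c"
    have x: "x \<in> carrier_vec m" using Z' c by (simp add: x_def)
    have xa: "x $ a = (\<Sum>k<K. c $ k * cnj (Z $$ (a, k)))" if "a < m" for a
      using mult_mat_vec_sum[OF Z' c(1) that] Z that by (simp add: x_def Z'_def)
    have "Y *\<^sub>v x = 0\<^sub>v K" using Y Z' c by (simp add: x_def T_def)
    then have z: "(\<Sum>a<m. x $ a * Z $$ (a, k)) = 0" if "k < K" for k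
      using Yx[OF that x] Dn that by simp
    \<comment> \<open>Here \<open>x\<close> is a combination of the conjugated columns of
      \<open>Z\<close>, while \<open>z\<close> says that it is orthogonal to each of them; so it is
      orthogonal to itself.\<close>
    have "of_real (\<Sum>a<m. (cmod (x $ a))\<^sup>2) = (\<Sum>a<m. x $ a * cnj (x $ a))"
      by (rule sum_mult_cnj_self[symmetric])
    also have "\<dots> = (\<Sum>a<m. \<Sum>k<K. cnj (c $ k) * (x $ a * Z $$ (a, k)))"
      by (intro sum.cong refl) (simp add: xa[THEN arg_cong, of _ cnj] sum_distrib_left mult_ac)
    also have "\<dots> = (\<Sum>k<K. cnj (c $ k) * (\<Sum>a<m. x $ a * Z $$ (a, k)))"
      unfolding sum_distrib_left by (rule sum.swap)
    also have "\<dots> = 0" using z by simp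
    finally have "(\<Sum>a<m. (cmod (x $ a))\<^sup>2) = 0" by (simp only: of_real_eq_0_iff)
    then have x0: "x $ a = 0" if "a < m" for a using that by (simp add: sum_nonneg_eq_0_iff)
    \<comment> \<open>Injectivity is assumed for \<open>Z\<close> but the kernel relation concerns
      its conjugate; conjugating the coordinates passes between them.\<close>
    define c' where "c' = vec K (\<lambda>k. cnj (c $ k))"
    have "Z *\<^sub>v c' = 0\<^sub>v m"
    proof (rule eq_vecI)
      fix a assume "a < dim_vec (0\<^sub>v m :: complex vec)"
      then have a: "a < m" by simp
      have "(Z *\<^sub>v c') $ a = (\<Sum>k<K. cnj (c $ k) * Z $$ (a, k))"
        using mult_mat_vec_sum[OF Z _ a, of c'] by (simp add: c'_def)
      also have "\<dots> = cnj (x $ a)" by (simp add: xa[OF a])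
      finally show "(Z *\<^sub>v c') $ a = 0\<^sub>v m $ a" using x0[OF a] a by simp
    qed (use Z in simp)
    then have "c' = 0\<^sub>v K" by (intro inj) (simp add: c'_def)
    then have "cnj (c $ k) = 0" if "k < K" for k
      using that by (metis c'_def index_vec index_zero_vec(1))
    then show ?thesis using c(1) by (intro eq_vecI) auto
  qed
  then have "det T \<noteq> 0" using det_0_iff_vec_prod_zero_field[OF T] by blast
  from det_non_zero_imp_unit[OF T this, of "()"]
  obtain T' where T': "T' \<in> carrier_mat K K" "T * T' = 1\<^sub>m K"
    by (auto simp: Units_def ring_mat_def)
  have "Y *\<^sub>v (Z' *\<^sub>v (T' *\<^sub>v y)) = T *\<^sub>v (T' *\<^sub>v y)"
    unfolding T_def using Y Z' T' y by (intro assoc_mult_mat_vec[symmetric]) auto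
  also have "\<dots> = (T * T') *\<^sub>v y" using T T'(1) y by (intro assoc_mult_mat_vec[symmetric]) auto
  also have "\<dots> = y" using T'(2) y by simp
  finally show ?thesis using Z' T' y unfolding Y_def by (intro bexI) auto
qed

lemma ctranspose_mult_transpose:
  assumes "P \<in> carrier_mat n K" "Z \<in> carrier_mat m K"
  shows "ctranspose (P * transpose_mat Z) = map_mat cnj Z * map_mat cnj (transpose_mat P)"
  using assms by (intro eq_matI) (auto simp: ctranspose_def scalar_prod_def mult.commute)

section \<open>The data matrix of two nearly orthogonal factors\<close>

locale target_data =
  fixes n m K :: nat and b :: real and X Z D :: "complex mat"
  assumes X: "nearly_orthogonal n K b X" and Z: "nearly_orthogonal m K b Z"
    and D: "nonzero_diag K D" and K: "0 < K" and b: "0 \<le> b"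
    and n_pos: "0 < real n - (real K - 1) * b" and m_pos: "0 < real m - (real K - 1) * b"
begin

abbreviation A where "A \<equiv> X * D * transpose_mat Z"

lemma carriers: "X \<in> carrier_mat n K" "Z \<in> carrier_mat m K" "D \<in> carrier_mat K K" "A \<in> carrier_mat n m"
  using X Z D by (auto simp: nearly_orthogonal_def nonzero_diag_def)

lemma dims [simp]:
  "dim_row X = n" "dim_col X = K" "dim_row Z = m" "dim_col Z = K" "dim_row A = n" "dim_col A = m"
  using carriers by auto

lemma sizes: "0 < n" "0 < m"
proof -
  have "0 \<le> (real K - 1) * b" using K b by simp
  then show "0 < n" "0 < m" using n_pos m_pos by linarith+
qed

lemma A_assoc: "A = X * (D * transpose_mat Z)"
  using carriers by (intro assoc_mult_mat) auto

text \<open>Surjectivity of \<open>D * transpose_mat Z\<close> gives equality and not merely an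
  inclusion; \<open>rank_A\<close> rests on it.\<close>

lemma range_A: "mat_range A = mat_range X"
proof
  show "mat_range A \<subseteq> mat_range X"
    unfolding A_assoc using carriers(2,3) by (intro mat_range_mult_subset[OF carriers(1), of _ m]) auto
  show "mat_range X \<subseteq> mat_range A"
  proof
    fix y assume "y \<in> mat_range X"
    then obtain c where c: "c \<in> carrier_vec K" "y = X *\<^sub>v c" using carriers by (auto simp: mat_range_def)
    obtain w where w: "w \<in> carrier_vec m" "(D * transpose_mat Z) *\<^sub>v w = c"
      using diag_transpose_surj[OF D carriers(2) nearly_orthogonal_injective[OF Z b m_pos] c(1)] by blast
    have "A *\<^sub>v w = X *\<^sub>v ((D * transpose_mat Z) *\<^sub>v w)"
      unfolding A_assoc using carriers w by (intro assoc_mult_mat_vec) auto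
    then show "y \<in> mat_range A" using w c by (auto simp: mat_range_def intro!: exI[of _ w])
  qed
qed

lemma rank_A: "vec_space.rank n A = K"
proof -
  have "vec_space.rank n A = vec_space.rank n X"
    using rank_eq_cdim[OF carriers(4)] rank_eq_cdim[OF carriers(1)] range_A by simp
  also have "\<dots> = K"
    by (rule vec_space.rank_of_injective[OF carriers(1) nearly_orthogonal_injective[OF X b n_pos]])
  finally show ?thesis .
qed

lemma ctranspose_range: "mat_range (ctranspose A) \<subseteq> mat_range (map_mat cnj Z)"
proof -
  have "ctranspose A = map_mat cnj Z * map_mat cnj (transpose_mat (X * D))"
    by (rule ctranspose_mult_transpose[OF mult_carrier_mat[OF carriers(1,3)] carriers(2)])
  then show ?thesis
    using mat_range_mult_subset[of "map_mat cnj Z" m K "map_mat cnj (transpose_mat (X * D))" n] carriers(1-3)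
    by simp
qed

lemma svd_bounds:
  assumes "compact_svd A r s u v"
  shows "r = K"
    and "a < n \<Longrightarrow> (\<Sum>i<r. (cmod (u i $ a))\<^sup>2) \<le> real K / (real n - (real K - 1) * b)"
    and "a' < m \<Longrightarrow> (\<Sum>i<r. (cmod (v i $ a'))\<^sup>2) \<le> real K / (real m - (real K - 1) * b)"
proof -
  show "r = K" using assms rank_A by (simp add: compact_svd_def)
  show "(\<Sum>i<r. (cmod (u i $ a))\<^sup>2) \<le> real K / (real n - (real K - 1) * b)" if "a < n"
    by (rule row_energy_bound[OF assms equalityD1[OF range_A], unfolded dims, OF X b n_pos that])
  have dm: "dim_row (ctranspose A) = m" by (simp add: ctranspose_def)
  show "(\<Sum>i<r. (cmod (v i $ a'))\<^sup>2) \<le> real K / (real m - (real K - 1) * b)" if "a' < m"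
    by (rule row_energy_bound[OF compact_svd_ctranspose[OF assms] ctranspose_range, unfolded dm,
          OF nearly_orthogonal_cnj[OF Z] b m_pos that])
qed

text \<open>Since \<open>r = K\<close>, the normalisation \<open>n / r\<close> cancels the
  \<open>K\<close> in the row energy bound.\<close>

lemma coherence_left:
  "1 \<le> coherence n (left_space A)"
  "coherence n (left_space A) \<le> real n / (real n - (real K - 1) * b)"
proof -
  obtain r s u v where svd: "compact_svd A r s u v" using compact_svd_exists by blast
  note bd = svd_bounds[OF svd]
  show "1 \<le> coherence n (left_space A)"
    using coherence_bounds(1)[OF svd] sizes K bd(1) by (simp add: left_space_eq)
  show "coherence n (left_space A) \<le> real n / (real n - (real K - 1) * b)"
    using coherence_bounds(2)[OF svd _ _ bd(2)] sizes K bd(1) by (simp add: left_space_eq)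
qed

lemma coherence_right:
  "1 \<le> coherence m (right_space A)"
  "coherence m (right_space A) \<le> real m / (real m - (real K - 1) * b)"
proof -
  obtain r s u v where svd: "compact_svd A r s u v" using compact_svd_exists by blast
  note bd = svd_bounds[OF svd]
  have dm: "dim_row (ctranspose A) = m" by (simp add: ctranspose_def)
  note cb = coherence_bounds[OF compact_svd_ctranspose[OF svd], unfolded dm]
  show "1 \<le> coherence m (right_space A)"
    using cb(1) sizes K bd(1) by (simp add: right_space_eq)
  show "coherence m (right_space A) \<le> real m / (real m - (real K - 1) * b)"
    using cb(2)[OF _ _ bd(3)] sizes K bd(1) by (simp add: right_space_eq)
qed

lemma A0:
  "obeys_A0 A (max (real m / (real m - (real K - 1) * b)) (real n / (real n - (real K - 1) * b)))"
  unfolding obeys_A0_def dims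
  using coherence_left coherence_right sizes n_pos by (auto simp: less_max_iff_disj le_max_iff_disj)

text \<open>The product of the two row energy bounds equals \<open>p * q * (K / (n * m))\<close>.
  The common bound comes from estimating the geometric mean of \<open>p\<close> and \<open>q\<close>
  by their maximum, with the rank \<open>r = K\<close> under the root.\<close>

lemma A1:
  "obeys_A1 A (max (real m * sqrt (real K) / (real m - (real K - 1) * b))
     (real n * sqrt (real K) / (real n - (real K - 1) * b)))" (is "obeys_A1 A ?\<mu>")
  unfolding obeys_A1_def dims
proof (intro conjI allI impI)
  define \<delta>n \<delta>m where "\<delta>n = real n - (real K - 1) * b" and "\<delta>m = real m - (real K - 1) * b"
  define p q where "p = real m * sqrt (real K) / \<delta>m" and "q = real n * sqrt (real K) / \<delta>n"
  have d: "0 < \<delta>n" "0 < \<delta>m" using n_pos m_pos by (simp_all add: \<delta>n_def \<delta>m_def)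
  have pq: "0 < p" "0 < q" using sizes K d by (simp_all add: p_def q_def)
  have mu: "?\<mu> = max p q" by (simp add: p_def q_def \<delta>n_def \<delta>m_def)
  show "0 < ?\<mu>" unfolding mu using pq by simp
  show "\<exists>r s u v. compact_svd A r s u v" by (rule compact_svd_exists)
  fix r s u v assume svd: "compact_svd A r s u v"
  note bd = svd_bounds[OF svd, folded \<delta>n_def \<delta>m_def]
  have ent: "cmod (\<Sum>i<r. u i $ a * cnj (v i $ c)) \<le> ?\<mu> * sqrt (real r / (real n * real m))"
    if "a < n" "c < m" for a c
  proof (rule power2_le_imp_le)
    have "cmod (\<Sum>i<r. u i $ a * cnj (v i $ c)) \<le> (\<Sum>i<r. cmod (u i $ a) * cmod (v i $ c))"
      by (rule order.trans[OF norm_sum]) (simp add: norm_mult)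
    then have "(cmod (\<Sum>i<r. u i $ a * cnj (v i $ c)))\<^sup>2 \<le> (\<Sum>i<r. cmod (u i $ a) * cmod (v i $ c))\<^sup>2"
      by (intro power_mono) auto
    also have "\<dots> \<le> (\<Sum>i<r. (cmod (u i $ a))\<^sup>2) * (\<Sum>i<r. (cmod (v i $ c))\<^sup>2)"
      by (rule Cauchy_Schwarz_ineq_sum)
    also have "\<dots> \<le> (real K / \<delta>n) * (real K / \<delta>m)"
      using bd(2)[OF that(1)] bd(3)[OF that(2)] d by (intro mult_mono sum_nonneg) auto
    also have "\<dots> = (p * q) * (real K / (real n * real m))"
      using sizes d by (simp add: p_def q_def field_simps)
    also have "\<dots> \<le> (max p q)\<^sup>2 * (real K / (real n * real m))"
      unfolding power2_eq_square using pq by (intro mult_right_mono mult_mono) auto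
    also have "\<dots> = (?\<mu> * sqrt (real r / (real n * real m)))\<^sup>2"
      unfolding mu by (simp add: power_mult_distrib bd(1))
    finally show "(cmod (\<Sum>i<r. u i $ a * cnj (v i $ c)))\<^sup>2 \<le> (?\<mu> * sqrt (real r / (real n * real m)))\<^sup>2" .
    show "0 \<le> ?\<mu> * sqrt (real r / (real n * real m))" unfolding mu using pq by simp
  qed
  define B where "B = mat n m (\<lambda>(a, c). \<Sum>i<r. u i $ a * cnj (v i $ c))"
  have "{cmod (B $$ (a, c)) | a c. a < n \<and> c < m} = (\<lambda>(a, c). cmod (B $$ (a, c))) ` ({..<n} \<times> {..<m})"
    by auto
  then have "finite {cmod (B $$ (a, c)) | a c. a < n \<and> c < m}" by simp
  moreover have "{cmod (B $$ (a, c)) | a c. a < n \<and> c < m} \<noteq> {}" using sizes by blast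
  ultimately have "max_abs_entry B \<le> ?\<mu> * sqrt (real r / (real n * real m))"
    unfolding max_abs_entry_def using ent by (subst Max_le_iff) (auto simp: B_def)
  then show "max_abs_entry (mat n m (\<lambda>(a, c). \<Sum>i<r. u i $ a * cnj (v i $ c)))
      \<le> ?\<mu> * sqrt (real r / (real n * real m))" by (simp only: B_def)
qed

end

section \<open>Steering matrices\<close>

text \<open>At half-wavelength spacing an off-diagonal Gram entry is a geometric sum with ratio
  \<open>q\<close> on the unit circle. Its numerator has modulus at most \<open>2\<close> and
  \<open>\<bar>q - 1\<bar>\<close> is \<open>2 * sin (pi * t)\<close>, so the bound does not depend
  on the number \<open>M\<close> of antennas.\<close>

lemma steering_nearly_orthogonal:
  assumes lam: "0 < lam" and x: "0 < x" "x \<le> 1/2"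
    and sep: "\<And>k l. k < K \<Longrightarrow> l < K \<Longrightarrow> k \<noteq> l \<Longrightarrow>
      sin (pi * x) \<le> sin (pi * (1 / 2 * \<bar>sin (\<theta> k) - sin (\<theta> l)\<bar>))"
  shows "nearly_orthogonal M K (sqrt (beta x)) (steering_mat lam (lam / 2) M K \<theta>)"
proof -
  define X where "X = steering_mat lam (lam / 2) M K \<theta>"
  have ent: "X $$ (a, k) = exp (\<i> * of_real (pi * real a * sin (\<theta> k)))" if "a < M" "k < K" for a k
    using that lam by (simp add: X_def steering_mat_def mult.assoc)
  have "cmod (\<Sum>a<M. X $$ (a, k) * cnj (X $$ (a, l))) \<le> sqrt (beta x)"
    if kl: "k < K" "l < K" "k \<noteq> l" for k l
  proof -
    define d where "d = pi * (sin (\<theta> k) - sin (\<theta> l))"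
    define q where "q = exp (\<i> * of_real d)"
    have "X $$ (a, k) * cnj (X $$ (a, l)) = q ^ a" if "a < M" for a
    proof -
      have "X $$ (a, k) * cnj (X $$ (a, l)) = exp (of_nat a * (\<i> * of_real d))"
        using that kl by (simp add: ent exp_cnj flip: exp_add) (simp add: d_def algebra_simps)
      also have "\<dots> = q ^ a" unfolding q_def by (rule exp_of_nat_mult)
      finally show ?thesis .
    qed
    then have sum: "(\<Sum>a<M. X $$ (a, k) * cnj (X $$ (a, l))) = (\<Sum>a<M. q ^ a)" by simp
    define t where "t = 1 / 2 * \<bar>sin (\<theta> k) - sin (\<theta> l)\<bar>"
    have sx: "0 < sin (pi * x)" by (rule sin_pi_mono(1)[OF x(1) order_refl x(2)])
    have st: "sin (pi * x) \<le> sin (pi * t)" unfolding t_def by (rule sep[OF kl])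
    have "d / 2 = pi * t \<or> d / 2 = - (pi * t)" by (auto simp: d_def t_def abs_if algebra_simps)
    then have "\<bar>sin (d / 2)\<bar> = sin (pi * t)" using sx st by auto
    then have q1: "cmod (q - 1) = 2 * sin (pi * t)" unfolding q_def dist_exp_i_1 by simp
    then have "q \<noteq> 1" using sx st by auto
    then have "cmod (\<Sum>a<M. q ^ a) = cmod (q ^ M - 1) / cmod (q - 1)"
      by (simp add: geometric_sum norm_divide)
    also have "\<dots> \<le> 2 / (2 * sin (pi * t))"
    proof -
      have "cmod (q ^ M - 1) \<le> cmod (q ^ M) + cmod 1" by (rule norm_triangle_ineq4)
      then have "cmod (q ^ M - 1) \<le> 2" by (simp add: q_def norm_power)
      then show ?thesis unfolding q1 using sx st by (intro divide_right_mono) auto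
    qed
    also have "\<dots> = 1 / sin (pi * t)" by simp
    also have "\<dots> \<le> 1 / sin (pi * x)" using sx st by (intro divide_left_mono) auto
    also have "\<dots> = sqrt (beta x)" by (rule sqrt_beta[OF x, symmetric])
    finally show ?thesis unfolding sum .
  qed
  moreover have "cmod (X $$ (a, k)) = 1" if "a < M" "k < K" for a k
    unfolding ent[OF that] by (rule norm_exp_i_times)
  moreover have "X \<in> carrier_mat M K" by (simp add: X_def steering_mat_def)
  ultimately show ?thesis unfolding nearly_orthogonal_def X_def[symmetric] by blast
qed

lemma admissible_steering:
  assumes lam: "0 < lam" and \<eta>: "0 < \<eta>" "\<eta> \<le> pi / 2" and adm: "admissible \<eta> K \<phi>"
    and x: "x = 1 - cos (\<eta> / 2) \<or> 2 \<le> K \<and> x = xi lam (lam / 2) (lam / 2) K \<phi>"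
  shows "0 < x" "x \<le> 1/2"
    "nearly_orthogonal M K (sqrt (beta x)) (steering_mat lam (lam / 2) M K \<phi>)"
proof -
  note e = xi_least_bounds[OF \<eta>]
  show x01: "0 < x" "x \<le> 1/2"
    using x e(1,3) xi_ge[OF lam _ adm \<eta>] by (elim disjE; fastforce)+
  show "nearly_orthogonal M K (sqrt (beta x)) (steering_mat lam (lam / 2) M K \<phi>)"
  proof (rule steering_nearly_orthogonal[OF lam x01])
    fix k l assume kl: "k < K" "l < K" "k \<noteq> l"
    define t where "t = 1 / 2 * \<bar>sin (\<phi> k) - sin (\<phi> l)\<bar>"
    have "(\<phi> k, \<phi> l) \<in> angle_region \<eta>" using adm kl by (simp add: admissible_def)
    note g = gap_bounds[OF this \<eta>, folded t_def]
    have "x \<le> gap t" using x g(3) xi_le_gap[OF lam kl, of \<phi>] by (auto simp: t_def)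
    then have "sin (pi * x) \<le> sin (pi * gap t)" using sin_pi_mono(2)[OF x01(1) _ g(4)] by blast
    then show "sin (pi * x) \<le> sin (pi * (1 / 2 * \<bar>sin (\<phi> k) - sin (\<phi> l)\<bar>))"
      unfolding g(5) by (simp only: t_def)
  qed
qed

section \<open>From admissible angles to bounds, monotonicity and limits\<close>

lemma sqrt_beta_pos:
  assumes "0 < x" "x \<le> 1/2"
  shows "0 < sqrt (beta x)"
  using sqrt_beta[OF assms] sin_pi_mono(1)[OF assms(1) order_refl assms(2)] by simp

text \<open>The denominator is at least \<open>b\<close>, the margin left by the threshold
  \<open>K * b\<close>.\<close>

lemma denominator_pos:
  fixes b :: real
  assumes "0 < b" "real K * b \<le> real M"
  shows "0 < real M - (real K - 1) * b"
  using assms by (simp add: algebra_simps)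

lemma admissible_target_data:
  assumes lam: "0 < lam" and \<eta>: "0 < \<eta>" "\<eta> \<le> pi / 2" and adm: "admissible \<eta> K \<phi>"
    and x: "x = 1 - cos (\<eta> / 2) \<or> 2 \<le> K \<and> x = xi lam (lam / 2) (lam / 2) K \<phi>"
    and K: "1 \<le> K" and D: "nonzero_diag K D"
    and M: "real K * sqrt (beta x) \<le> real Mr" "real K * sqrt (beta x) \<le> real Mt"
  shows "target_data Mr Mt K (sqrt (beta x))
    (steering_mat lam (lam / 2) Mr K \<phi>) (steering_mat lam (lam / 2) Mt K \<phi>) D"
proof -
  note a = admissible_steering[OF lam \<eta> adm x]
  have b: "0 < sqrt (beta x)" by (rule sqrt_beta_pos[OF a(1,2)])
  show ?thesis
    using a(3) D K b denominator_pos[OF b M(1)] denominator_pos[OF b M(2)]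
    by unfold_locales auto
qed

lemma ratio_tendsto_1: "(\<lambda>n. real n / (real n - c)) \<longlonglongrightarrow> 1"
  by real_asymp

text \<open>A larger \<open>\<eta>\<close> raises \<open>sin (pi * x)\<close>, lowers
  \<open>sqrt (beta x)\<close> and so enlarges the denominators. The threshold at
  \<open>\<eta>1\<close> is the stricter one and covers both parameters. Strictness needs
  \<open>K - 1 > 0\<close>.\<close>

lemma mu0_strict_antimono:
  assumes \<eta>: "0 < \<eta>1" "\<eta>1 < \<eta>2" "\<eta>2 \<le> pi / 2"
  shows "1 - cos (\<eta>1 / 2) < 1 - cos (\<eta>2 / 2)"
    and "1 \<le> K \<Longrightarrow> real K * sqrt (beta (1 - cos (\<eta>1 / 2))) \<le> real (min Mt Mr) \<Longrightarrow>
      mu0 K (1 - cos (\<eta>2 / 2)) Mr Mt \<le> mu0 K (1 - cos (\<eta>1 / 2)) Mr Mt"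
    and "2 \<le> K \<Longrightarrow> real K * sqrt (beta (1 - cos (\<eta>1 / 2))) \<le> real (min Mt Mr) \<Longrightarrow>
      mu0 K (1 - cos (\<eta>2 / 2)) Mr Mt < mu0 K (1 - cos (\<eta>1 / 2)) Mr Mt"
proof -
  define x y where "x = 1 - cos (\<eta>1 / 2)" and "y = 1 - cos (\<eta>2 / 2)"
  have "cos (\<eta>2 / 2) < cos (\<eta>1 / 2)" using \<eta> by (intro cos_monotone_0_pi) auto
  then have xy: "x < y" by (simp add: x_def y_def)
  then show "1 - cos (\<eta>1 / 2) < 1 - cos (\<eta>2 / 2)" by (simp add: x_def y_def)
  have x: "0 < x" "x \<le> 1/2" and y: "0 < y" "y \<le> 1/2"
    using xi_least_bounds[of \<eta>1] xi_least_bounds[of \<eta>2] \<eta> by (simp_all add: x_def y_def)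
  define b c where "b = sqrt (beta x)" and "c = sqrt (beta y)"
  have b0: "0 < b" unfolding b_def by (rule sqrt_beta_pos[OF x])
  have cb: "c < b"
    unfolding b_def c_def sqrt_beta[OF x] sqrt_beta[OF y]
    using sin_pi_mono[OF x(1) less_imp_le[OF xy] y(2)] xy by (intro divide_strict_left_mono) auto
  have f: "real M / (real M - (real K - 1) * c) \<le> real M / (real M - (real K - 1) * b)"
      "2 \<le> K \<Longrightarrow> real M / (real M - (real K - 1) * c) < real M / (real M - (real K - 1) * b)"
    if K: "1 \<le> K" and M: "real K * b \<le> real M" for M
  proof -
    have d: "0 < real M - (real K - 1) * b" by (rule denominator_pos[OF b0 M])
    have "0 < real K * b" using K b0 by simp
    then have M0: "0 < real M" using M by linarith
    have le: "(real K - 1) * c \<le> (real K - 1) * b" using K cb by (intro mult_left_mono) auto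
    show "real M / (real M - (real K - 1) * c) \<le> real M / (real M - (real K - 1) * b)"
      using d le by (intro divide_left_mono) auto
    assume "2 \<le> K"
    then have "(real K - 1) * c < (real K - 1) * b" using cb by (intro mult_strict_left_mono) auto
    then show "real M / (real M - (real K - 1) * c) < real M / (real M - (real K - 1) * b)"
      using d M0 by (intro divide_strict_left_mono) auto
  qed
  have M: "real K * b \<le> real Mt" "real K * b \<le> real Mr"
    if "real K * sqrt (beta (1 - cos (\<eta>1 / 2))) \<le> real (min Mt Mr)"
    using that by (simp_all add: b_def x_def)
  have mu0: "mu0 K (1 - cos (\<eta>1 / 2)) Mr Mt = max (real Mt / (real Mt - (real K - 1) * b)) (real Mr / (real Mr - (real K - 1) * b))"
      "mu0 K (1 - cos (\<eta>2 / 2)) Mr Mt = max (real Mt / (real Mt - (real K - 1) * c)) (real Mr / (real Mr - (real K - 1) * c))"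
    by (simp_all add: mu0_def Let_def b_def c_def x_def y_def)
  show "mu0 K (1 - cos (\<eta>2 / 2)) Mr Mt \<le> mu0 K (1 - cos (\<eta>1 / 2)) Mr Mt"
    if "1 \<le> K" "real K * sqrt (beta (1 - cos (\<eta>1 / 2))) \<le> real (min Mt Mr)"
    unfolding mu0 using f(1)[OF that(1) M(1)[OF that(2)]] f(1)[OF that(1) M(2)[OF that(2)]]
    by (intro max.mono)
  show "mu0 K (1 - cos (\<eta>2 / 2)) Mr Mt < mu0 K (1 - cos (\<eta>1 / 2)) Mr Mt"
    if "2 \<le> K" "real K * sqrt (beta (1 - cos (\<eta>1 / 2))) \<le> real (min Mt Mr)"
    unfolding mu0 using f(2)[OF _ M(1)[OF that(2)]] f(2)[OF _ M(2)[OF that(2)]] that(1)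
    by (auto simp: less_max_iff_disj)
qed

lemma admissible_bounds:
  assumes lam: "0 < lam" and \<eta>: "0 < \<eta>" "\<eta> \<le> pi / 2" and adm: "admissible \<eta> K \<phi>"
    and x: "x = 1 - cos (\<eta> / 2) \<or> 2 \<le> K \<and> x = xi lam (lam / 2) (lam / 2) K \<phi>"
    and K: "1 \<le> K" and D: "nonzero_diag K D"
    and M: "real K * sqrt (beta x) \<le> real (min Mt Mr)"
  defines "\<Delta> \<equiv> data_mat lam (lam / 2) (lam / 2) Mr Mt K \<phi> D"
  shows "obeys_A0 \<Delta> (mu0 K x Mr Mt)" "obeys_A1 \<Delta> (mu1 K x Mr Mt)"
    "1 \<le> coherence Mr (left_space \<Delta>)"
    "coherence Mr (left_space \<Delta>) \<le> real Mr / (real Mr - (real K - 1) * sqrt (beta x))"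
    "1 \<le> coherence Mt (right_space \<Delta>)"
    "coherence Mt (right_space \<Delta>) \<le> real Mt / (real Mt - (real K - 1) * sqrt (beta x))"
proof -
  interpret target_data Mr Mt K "sqrt (beta x)"
    "steering_mat lam (lam / 2) Mr K \<phi>" "steering_mat lam (lam / 2) Mt K \<phi>" D
    using M by (intro admissible_target_data[OF lam \<eta> adm x K D]) auto
  have \<Delta>: "\<Delta> = A" by (simp only: \<Delta>_def data_mat_def)
  show "obeys_A0 \<Delta> (mu0 K x Mr Mt)" unfolding \<Delta> mu0_def Let_def by (rule A0)
  show "obeys_A1 \<Delta> (mu1 K x Mr Mt)" unfolding \<Delta> mu1_def Let_def by (rule A1)
  show "1 \<le> coherence Mr (left_space \<Delta>)"
    "coherence Mr (left_space \<Delta>) \<le> real Mr / (real Mr - (real K - 1) * sqrt (beta x))"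
    unfolding \<Delta> by (rule coherence_left)+
  show "1 \<le> coherence Mt (right_space \<Delta>)"
    "coherence Mt (right_space \<Delta>) \<le> real Mt / (real Mt - (real K - 1) * sqrt (beta x))"
    unfolding \<Delta> by (rule coherence_right)+
qed

text \<open>Each coherence is squeezed between \<open>1\<close> and a function \<open>g\<close> of
  its own dimension. The bounds do not involve \<open>D\<close>, so \<open>D\<close> may vary with
  the sizes, and the two dimensions may grow at unrelated rates.\<close>

lemma admissible_coherence_limit:
  assumes lam: "0 < lam" and \<eta>: "0 < \<eta>" "\<eta> \<le> pi / 2" and adm: "admissible \<eta> K \<phi>"
    and K: "1 \<le> K" and D: "\<And>Mr Mt. nonzero_diag K (D Mr Mt)"
  defines "\<Delta> \<equiv> \<lambda>Mr Mt. data_mat lam (lam / 2) (lam / 2) Mr Mt K \<phi> (D Mr Mt)"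
  shows "((\<lambda>(Mr, Mt). coherence Mr (left_space (\<Delta> Mr Mt))) \<longlongrightarrow> 1) (sequentially \<times>\<^sub>F sequentially)"
    and "((\<lambda>(Mr, Mt). coherence Mt (right_space (\<Delta> Mr Mt))) \<longlongrightarrow> 1) (sequentially \<times>\<^sub>F sequentially)"
proof -
  define b where "b = sqrt (beta (1 - cos (\<eta> / 2)))"
  define g where "g M = real M / (real M - (real K - 1) * b)" for M
  have g: "g \<longlonglongrightarrow> 1" unfolding g_def by (rule ratio_tendsto_1)
  have large: "\<forall>\<^sub>F M in sequentially. real K * b \<le> real M"
    using filterlim_real_sequentially by (simp add: filterlim_at_top)
  have ev: "\<forall>\<^sub>F p in sequentially \<times>\<^sub>F sequentially. real K * b \<le> real (fst p) \<and> real K * b \<le> real (snd p)"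
    using eventually_prodI[OF large large] by simp
  have bounds: "1 \<le> coherence Mr (left_space (\<Delta> Mr Mt))" "coherence Mr (left_space (\<Delta> Mr Mt)) \<le> g Mr"
      "1 \<le> coherence Mt (right_space (\<Delta> Mr Mt))" "coherence Mt (right_space (\<Delta> Mr Mt)) \<le> g Mt"
    if "real K * b \<le> real Mr" "real K * b \<le> real Mt" for Mr Mt
  proof -
    have "real K * sqrt (beta (1 - cos (\<eta> / 2))) \<le> real (min Mt Mr)" using that by (simp add: b_def min_def)
    note ab = admissible_bounds[OF lam \<eta> adm disjI1[OF refl] K D this]
    show "1 \<le> coherence Mr (left_space (\<Delta> Mr Mt))" "coherence Mr (left_space (\<Delta> Mr Mt)) \<le> g Mr"
      "1 \<le> coherence Mt (right_space (\<Delta> Mr Mt))" "coherence Mt (right_space (\<Delta> Mr Mt)) \<le> g Mt"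
      using ab(3-6) unfolding \<Delta>_def g_def b_def by blast+
  qed
  show "((\<lambda>(Mr, Mt). coherence Mr (left_space (\<Delta> Mr Mt))) \<longlongrightarrow> 1) (sequentially \<times>\<^sub>F sequentially)"
  proof (rule tendsto_sandwich[OF _ _ tendsto_const filterlim_compose[OF g filterlim_fst]])
    show "\<forall>\<^sub>F p in sequentially \<times>\<^sub>F sequentially. 1 \<le> (case p of (Mr, Mt) \<Rightarrow> coherence Mr (left_space (\<Delta> Mr Mt)))"
      using ev by eventually_elim (auto intro: bounds)
    show "\<forall>\<^sub>F p in sequentially \<times>\<^sub>F sequentially. (case p of (Mr, Mt) \<Rightarrow> coherence Mr (left_space (\<Delta> Mr Mt))) \<le> g (fst p)"
      using ev by eventually_elim (auto intro: bounds)
  qed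
  show "((\<lambda>(Mr, Mt). coherence Mt (right_space (\<Delta> Mr Mt))) \<longlongrightarrow> 1) (sequentially \<times>\<^sub>F sequentially)"
  proof (rule tendsto_sandwich[OF _ _ tendsto_const filterlim_compose[OF g filterlim_snd]])
    show "\<forall>\<^sub>F p in sequentially \<times>\<^sub>F sequentially. 1 \<le> (case p of (Mr, Mt) \<Rightarrow> coherence Mt (right_space (\<Delta> Mr Mt)))"
      using ev by eventually_elim (auto intro: bounds)
    show "\<forall>\<^sub>F p in sequentially \<times>\<^sub>F sequentially. (case p of (Mr, Mt) \<Rightarrow> coherence Mt (right_space (\<Delta> Mr Mt))) \<le> g (snd p)"
      using ev by eventually_elim (auto intro: bounds)
  qed
qed

theorem lemma2:
  fixes P :: "'w measure" and \<theta> :: "nat \<Rightarrow> 'w \<Rightarrow> real"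
    and K :: nat and lam dr dt \<eta> :: real
  assumes "prob_space P"
    and "K \<ge> 1"
    and "lam > 0"
    and "\<forall>k<K. \<theta> k \<in> borel_measurable P"
    and "AE \<omega> in P. inj_on (\<lambda>k. \<theta> k \<omega>) {..<K}"
    and "dr = lam / 2" and "dt = lam / 2"
    and "0 < \<eta>" and "\<eta> \<le> pi / 2"
    and "AE \<omega> in P. admissible \<eta> K (\<lambda>k. \<theta> k \<omega>)"
  shows "let \<xi> = 1 - cos (\<eta> / 2) in
     \<comment> \<open>\<open>\<xi>\<close> is the least value over all admissible angles, in particular a lower bound for the
         random value at the given angles\<close>
     (2 \<le> K \<longrightarrow>
        (\<exists>\<phi>. admissible \<eta> K \<phi> \<and> xi lam dr dt K \<phi> = \<xi>) \<and>
        (\<forall>\<phi>. admissible \<eta> K \<phi> \<longrightarrow> \<xi> \<le> xi lam dr dt K \<phi>) \<and>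
        (AE \<omega> in P. \<xi> \<le> xi lam dr dt K (\<lambda>k. \<theta> k \<omega>))) \<and>
     \<xi> \<in> {0<..(2 - sqrt 2) / 2} \<and>
     (\<lambda>k::nat. real k * sqrt (beta \<xi>)) \<in> O(\<lambda>k. real k) \<and>
     \<comment> \<open>the bounds, for the least value \<open>\<xi>\<close> as well as for the random value at the given angles\<close>
     (AE \<omega> in P. \<forall>x Mr Mt D.
        (x = \<xi> \<or> 2 \<le> K \<and> x = xi lam dr dt K (\<lambda>k. \<theta> k \<omega>)) \<and>
        nonzero_diag K D \<and>
        real K * sqrt (beta x) \<le> real (min Mt Mr) \<longrightarrow>
          obeys_A0 (data_mat lam dr dt Mr Mt K (\<lambda>k. \<theta> k \<omega>) D) (mu0 K x Mr Mt) \<and>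
          obeys_A1 (data_mat lam dr dt Mr Mt K (\<lambda>k. \<theta> k \<omega>) D) (mu1 K x Mr Mt) \<and>
          1 \<le> coherence Mr (left_space (data_mat lam dr dt Mr Mt K (\<lambda>k. \<theta> k \<omega>) D)) \<and>
          1 \<le> coherence Mt (right_space (data_mat lam dr dt Mr Mt K (\<lambda>k. \<theta> k \<omega>) D))) \<and>
     (AE \<omega> in P. \<forall>D. (\<forall>Mr Mt. nonzero_diag K (D Mr Mt)) \<longrightarrow>
        ((\<lambda>(Mr, Mt). coherence Mr
            (left_space (data_mat lam dr dt Mr Mt K (\<lambda>k. \<theta> k \<omega>) (D Mr Mt)))) \<longlongrightarrow> 1)
          (sequentially \<times>\<^sub>F sequentially) \<and>
        ((\<lambda>(Mr, Mt). coherence Mt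
            (right_space (data_mat lam dr dt Mr Mt K (\<lambda>k. \<theta> k \<omega>) (D Mr Mt)))) \<longlongrightarrow> 1)
          (sequentially \<times>\<^sub>F sequentially)) \<and>
     \<comment> \<open>monotonicity in \<open>\<eta>\<close>; with a single target the bound is constantly \<open>1\<close>\<close>
     (\<forall>\<eta>1 \<eta>2. 0 < \<eta>1 \<and> \<eta>1 < \<eta>2 \<and> \<eta>2 \<le> pi / 2 \<longrightarrow>
        1 - cos (\<eta>1 / 2) < 1 - cos (\<eta>2 / 2) \<and>
        (\<forall>Mr Mt. real K * sqrt (beta (1 - cos (\<eta>1 / 2))) \<le> real (min Mt Mr) \<longrightarrow>
           mu0 K (1 - cos (\<eta>2 / 2)) Mr Mt \<le> mu0 K (1 - cos (\<eta>1 / 2)) Mr Mt \<and>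
           (2 \<le> K \<longrightarrow>
              mu0 K (1 - cos (\<eta>2 / 2)) Mr Mt < mu0 K (1 - cos (\<eta>1 / 2)) Mr Mt)))"
proof -
  interpret prob_space P by fact
  note K = assms(2) and lam = assms(3) and \<eta> = assms(8,9) and adm = assms(10)
  have d: "dr = lam / 2" "dt = lam / 2" by fact+
  define \<xi> where "\<xi> = 1 - cos (\<eta> / 2)"
  \<comment> \<open>A property holding almost surely in a probability space holds somewhere. This
    supplies the admissible \<open>K\<close>-tuple from which \<open>xi_attained\<close> builds its
    extremal one.\<close>
  obtain \<phi> where \<phi>: "admissible \<eta> K \<phi>"
    using eventually_happens'[OF ae_filter_bot adm] by blast
  have O: "(\<lambda>k::nat. real k * sqrt (beta \<xi>)) \<in> O(\<lambda>k. real k)"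
    by (rule bigoI[of _ "\<bar>sqrt (beta \<xi>)\<bar>"]) (simp add: abs_mult mult.commute)
  show ?thesis
    unfolding Let_def \<xi>_def[symmetric] d
  proof (intro conjI impI)
    show "\<exists>\<phi>. admissible \<eta> K \<phi> \<and> xi lam (lam / 2) (lam / 2) K \<phi> = \<xi>" if "2 \<le> K"
      unfolding \<xi>_def by (rule xi_attained[OF lam that \<phi> \<eta>])
    show "\<forall>\<phi>. admissible \<eta> K \<phi> \<longrightarrow> \<xi> \<le> xi lam (lam / 2) (lam / 2) K \<phi>" if "2 \<le> K"
      unfolding \<xi>_def using xi_ge(1)[OF lam that _ \<eta>] by blast
    show "AE \<omega> in P. \<xi> \<le> xi lam (lam / 2) (lam / 2) K (\<lambda>k. \<theta> k \<omega>)" if "2 \<le> K"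
      using adm by eventually_elim (simp add: \<xi>_def xi_ge(1)[OF lam that _ \<eta>])
    show "\<xi> \<in> {0<..(2 - sqrt 2) / 2}"
      using xi_least_bounds[OF \<eta>] by (simp add: \<xi>_def)
    show "(\<lambda>k::nat. real k * sqrt (beta \<xi>)) \<in> O(\<lambda>k. real k)" by (rule O)
    show "AE \<omega> in P. \<forall>x Mr Mt D.
        (x = \<xi> \<or> 2 \<le> K \<and> x = xi lam (lam / 2) (lam / 2) K (\<lambda>k. \<theta> k \<omega>)) \<and>
        nonzero_diag K D \<and>
        real K * sqrt (beta x) \<le> real (min Mt Mr) \<longrightarrow>
          obeys_A0 (data_mat lam (lam / 2) (lam / 2) Mr Mt K (\<lambda>k. \<theta> k \<omega>) D) (mu0 K x Mr Mt) \<and>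
          obeys_A1 (data_mat lam (lam / 2) (lam / 2) Mr Mt K (\<lambda>k. \<theta> k \<omega>) D) (mu1 K x Mr Mt) \<and>
          1 \<le> coherence Mr (left_space (data_mat lam (lam / 2) (lam / 2) Mr Mt K (\<lambda>k. \<theta> k \<omega>) D)) \<and>
          1 \<le> coherence Mt (right_space (data_mat lam (lam / 2) (lam / 2) Mr Mt K (\<lambda>k. \<theta> k \<omega>) D))"
      using adm
    proof eventually_elim
      case (elim \<omega>)
      show ?case
        unfolding \<xi>_def
      proof (intro allI impI, elim conjE)
        fix x Mr Mt D
        assume x: "x = 1 - cos (\<eta> / 2) \<or> 2 \<le> K \<and> x = xi lam (lam / 2) (lam / 2) K (\<lambda>k. \<theta> k \<omega>)"
          and D: "nonzero_diag K D" and M: "real K * sqrt (beta x) \<le> real (min Mt Mr)"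
        note ab = admissible_bounds[OF lam \<eta> elim x K D M]
        show "obeys_A0 (data_mat lam (lam / 2) (lam / 2) Mr Mt K (\<lambda>k. \<theta> k \<omega>) D) (mu0 K x Mr Mt) \<and>
          obeys_A1 (data_mat lam (lam / 2) (lam / 2) Mr Mt K (\<lambda>k. \<theta> k \<omega>) D) (mu1 K x Mr Mt) \<and>
          1 \<le> coherence Mr (left_space (data_mat lam (lam / 2) (lam / 2) Mr Mt K (\<lambda>k. \<theta> k \<omega>) D)) \<and>
          1 \<le> coherence Mt (right_space (data_mat lam (lam / 2) (lam / 2) Mr Mt K (\<lambda>k. \<theta> k \<omega>) D))"
          by (intro conjI ab(1,2,3,5))
      qed
    qed
    show "AE \<omega> in P. \<forall>D. (\<forall>Mr Mt. nonzero_diag K (D Mr Mt)) \<longrightarrow>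
        ((\<lambda>(Mr, Mt). coherence Mr
            (left_space (data_mat lam (lam / 2) (lam / 2) Mr Mt K (\<lambda>k. \<theta> k \<omega>) (D Mr Mt)))) \<longlongrightarrow> 1)
          (sequentially \<times>\<^sub>F sequentially) \<and>
        ((\<lambda>(Mr, Mt). coherence Mt
            (right_space (data_mat lam (lam / 2) (lam / 2) Mr Mt K (\<lambda>k. \<theta> k \<omega>) (D Mr Mt)))) \<longlongrightarrow> 1)
          (sequentially \<times>\<^sub>F sequentially)"
      using adm
    proof eventually_elim
      case (elim \<omega>)
      show ?case using admissible_coherence_limit[OF lam \<eta> elim K] by blast
    qed
    show "\<forall>\<eta>1 \<eta>2. 0 < \<eta>1 \<and> \<eta>1 < \<eta>2 \<and> \<eta>2 \<le> pi / 2 \<longrightarrow>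
        1 - cos (\<eta>1 / 2) < 1 - cos (\<eta>2 / 2) \<and>
        (\<forall>Mr Mt. real K * sqrt (beta (1 - cos (\<eta>1 / 2))) \<le> real (min Mt Mr) \<longrightarrow>
           mu0 K (1 - cos (\<eta>2 / 2)) Mr Mt \<le> mu0 K (1 - cos (\<eta>1 / 2)) Mr Mt \<and>
           (2 \<le> K \<longrightarrow>
              mu0 K (1 - cos (\<eta>2 / 2)) Mr Mt < mu0 K (1 - cos (\<eta>1 / 2)) Mr Mt))"
      using mu0_strict_antimono K by blast
  qed
qed

end
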